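(* Assume $d\geq 3$ and let $a,b>0$ be arbitrary. Then there exist $\epsilon_{b,a}>0$ and $\eta_{b,a}>0$ such that, for all $N$ large enough, \[ \tilde P_{N,a,b}\big(\tilde\xi_N>\epsilon_{b,a}N^d\ \big|\ \Omega_N^+\big)\ \geq\ 1-\exp(-\eta_{b,a}N^d). \]
   Context: Let $\Lambda_N=\{-\lfloor N/2\rfloor,\dots,\lfloor N/2\rfloor\}^d\subset\mathbb{Z}^d$ with outer boundary $\partial\Lambda_N$ (points of $\mathbb{Z}^d\setminus\Lambda_N$ at distance $1$ from $\Lambda_N$). For $\phi\in\mathbb{R}^{\mathbb{Z}^d}$ let $H(\phi)=\frac{1}{8d}\sum_{x,y\in \Lambda_N\cup\partial\Lambda_N,\ |x-y|=1}(\phi_x-\phi_y)^2$ (sum over ordered pairs). Define the probability measure \[ \tilde P_{N,a,b}(d\phi)=\frac{1}{\tilde Z_{N,a,b}}\exp\Big(-H(\phi)+b\sum_{x\in\Lambda_N}\mathbf{1}_{\{\phi_x\in[0,a]\}}\Big)\prod_{x\in\Lambda_N}d\phi_x\ \delta_0(d\phi_{\Lambda_N^c}), \] i.e. $\phi_x=0$ for $x\notin\Lambda_N$, with $\tilde Z_{N,a,b}$ the normalizing constant. Let $\tilde\xi_N=\sum_{x\in\Lambda_N}\mathbf{1}_{\{\phi_x\in[0,a]\}}$ and $\Omega_N^+=\{\phi_x\geq 0\ \forall x\in\Lambda_N\}$. *)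

theory Defs
  imports "HOL-Probability.Probability"
begin

text \<open>Points of Z^d are integer lists of length d. Fields are functions
  int list => real; the random field lives on the box Lambda_N, and is
  extended by 0 outside.\<close>

definition box :: "nat \<Rightarrow> nat \<Rightarrow> int list set" where
  "box d N = {x. length x = d \<and> (\<forall>i\<in>set x. \<bar>i\<bar> \<le> int (N div 2))}"

definition adj :: "int list \<Rightarrow> int list \<Rightarrow> bool" where
  "adj x y \<longleftrightarrow> length x = length y \<and> (\<Sum>i<length x. (x!i - y!i)^2) = 1"

definition outer_boundary :: "nat \<Rightarrow> nat \<Rightarrow> int list set" where
  "outer_boundary d N = {y. length y = d \<and> y \<notin> box d N \<and> (\<exists>x\<in>box d N. adj x y)}"

definition ext0 :: "nat \<Rightarrow> nat \<Rightarrow> (int list \<Rightarrow> real) \<Rightarrow> int list \<Rightarrow> real" where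
  "ext0 d N \<phi> x = (if x \<in> box d N then \<phi> x else 0)"

definition hamiltonian :: "nat \<Rightarrow> nat \<Rightarrow> (int list \<Rightarrow> real) \<Rightarrow> real" where
  "hamiltonian d N \<phi> = 1 / (8 * real d) *
     (\<Sum>p \<in> {(x,y). x \<in> box d N \<union> outer_boundary d N \<and> y \<in> box d N \<union> outer_boundary d N \<and> adj x y}.
        (ext0 d N \<phi> (fst p) - ext0 d N \<phi> (snd p))^2)"

definition xi :: "nat \<Rightarrow> nat \<Rightarrow> real \<Rightarrow> (int list \<Rightarrow> real) \<Rightarrow> nat" where
  "xi d N a \<phi> = card {x \<in> box d N. 0 \<le> \<phi> x \<and> \<phi> x \<le> a}"

definition ref_measure :: "nat \<Rightarrow> nat \<Rightarrow> (int list \<Rightarrow> real) measure" where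
  "ref_measure d N = PiM (box d N) (\<lambda>_. lborel)"

definition weight :: "nat \<Rightarrow> nat \<Rightarrow> real \<Rightarrow> real \<Rightarrow> (int list \<Rightarrow> real) \<Rightarrow> real" where
  "weight d N a b \<phi> = exp (- hamiltonian d N \<phi> + b * real (xi d N a \<phi>))"

definition partition_fn :: "nat \<Rightarrow> nat \<Rightarrow> real \<Rightarrow> real \<Rightarrow> ennreal" where
  "partition_fn d N a b = (\<integral>\<^sup>+ \<phi>. ennreal (weight d N a b \<phi>) \<partial>ref_measure d N)"

definition Ptilde :: "nat \<Rightarrow> nat \<Rightarrow> real \<Rightarrow> real \<Rightarrow> (int list \<Rightarrow> real) measure" where
  "Ptilde d N a b = density (ref_measure d N)
      (\<lambda>\<phi>. ennreal (weight d N a b \<phi>) / partition_fn d N a b)"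

definition Omega_plus :: "nat \<Rightarrow> nat \<Rightarrow> (int list \<Rightarrow> real) set" where
  "Omega_plus d N = {\<phi> \<in> space (ref_measure d N). \<forall>x\<in>box d N. 0 \<le> \<phi> x}"

definition cond_prob :: "'a measure \<Rightarrow> 'a set \<Rightarrow> 'a set \<Rightarrow> real" where
  "cond_prob M A B = measure M (A \<inter> B) / measure M B"

end

theory Submission
  imports Defs
begin

text \<open>
  Bounding the numerator by \<open>exp (b \<epsilon> N^d) Z\<close> with \<open>Z\<close> the partition function without wall and pinning,
  it suffices that the pinned partition function on the positive fields exceeds \<open>Z\<close> by a factor
  \<open>exp (\<mu> |\<Lambda>|)\<close>. Let \<open>Q\<close> be the centred Gaussian field whose energy has an additional mass \<open>\<mu>\<close>
  (and extra boundary mass). Comparing with \<open>Q\<close> shifted to height \<open>u\<close> costs only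
  \<open>O(\<mu> (1 + u^2))\<close> per site, because variances are bounded uniformly when \<open>d \<ge> 3\<close>.
  Put \<open>q(u) = Q(\<psi> \<ge> -u)\<close>. Jensen gives a lower bound with exponent
  \<open>ln q(u) + b X(u)\<close>, where \<open>X(u)\<close> is the mean number of contacts given \<open>\<psi> \<ge> -u\<close>.

  A configuration that violates \<open>\<psi> \<ge> -u\<close> at \<open>x\<close> by an infinitesimal amount can be lifted along the
  Green function of \<open>x\<close> into the contact window; the weight grows by \<open>exp (c u)\<close>. Hence
  \<open>X(u) \<ge> exp (2 \<kappa> u) (ln q)'(u)\<close>. If the claim failed, \<open>b X(u) \<le> -ln q(u) + O(\<mu> u^2 |\<Lambda>|)\<close> for all
  large \<open>u\<close>; integrating this differential inequality from \<open>u0\<close> to infinity forces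
  \<open>-ln q(u0) \<le> C \<mu> |\<Lambda>|\<close> with \<open>C\<close> and \<open>u0\<close> independent of \<open>\<mu>\<close>. Then the conditioned field has bounded
  mean height (again by Jensen), so a positive fraction of its sites can be lowered into the contact
  window at bounded cost, i.e. \<open>X(u0) \<ge> c |\<Lambda>|\<close> with \<open>c\<close> independent of \<open>\<mu>\<close>: a contradiction for
  small \<open>\<mu>\<close>.
\<close>

section \<open>Symmetric substochastic kernels and their Green functions\<close>

text \<open>A random walk killed on leaving \<open>I\<close>. \<open>supersolution\<close> encodes
  transience: \<open>f\<close> dominates the Green function with pole \<open>x\<close>, so its
  diagonal value is at most \<open>K\<close>. For boxes \<open>K\<close> will not depend on the side
  length, and this is how d >= 3 enters.\<close>

locale substochastic_kernel =
  fixes I :: "'i set" and w :: "'i \<Rightarrow> 'i \<Rightarrow> real" and K :: real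
  assumes fin: "finite I" and nonempty: "I \<noteq> {}"
    and sym: "\<And>x y. x \<in> I \<Longrightarrow> y \<in> I \<Longrightarrow> w x y = w y x"
    and nonneg: "\<And>x y. x \<in> I \<Longrightarrow> y \<in> I \<Longrightarrow> 0 \<le> w x y"
    and row_sum: "\<And>x. x \<in> I \<Longrightarrow> (\<Sum>y\<in>I. w x y) \<le> 1"
    and supersolution: "\<And>x. x \<in> I \<Longrightarrow> \<exists>f. (\<forall>y\<in>I. 0 \<le> f y) \<and>
          (\<forall>y\<in>I. (\<Sum>z\<in>I. w y z * f z) + (if y = x then 1 else 0) \<le> f y) \<and> f x \<le> K"
begin

text \<open>Half the quadratic form of the matrix \<open>1 + c - w\<close>; \<open>c\<close> is a
  site-dependent mass, and \<open>oper c\<close> below is the matrix itself.\<close>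

definition energy :: "('i \<Rightarrow> real) \<Rightarrow> ('i \<Rightarrow> real) \<Rightarrow> real" where
  "energy c \<psi> = (\<Sum>x\<in>I. (1 + c x) * (\<psi> x)\<^sup>2) / 2 - (\<Sum>x\<in>I. \<Sum>y\<in>I. w x y * \<psi> x * \<psi> y) / 2"

definition oper :: "('i \<Rightarrow> real) \<Rightarrow> ('i \<Rightarrow> real) \<Rightarrow> 'i \<Rightarrow> real" where
  "oper c r x = (1 + c x) * r x - (\<Sum>y\<in>I. w x y * r y)"

text \<open>The probability that one step of the walk leaves \<open>I\<close>.\<close>

definition killing :: "'i \<Rightarrow> real" where
  "killing x = 1 - (\<Sum>y\<in>I. w x y)"

lemma killing_bounds: "x \<in> I \<Longrightarrow> 0 \<le> killing x" "x \<in> I \<Longrightarrow> killing x \<le> 1"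
  using row_sum nonneg by (auto simp: killing_def sum_nonneg)

lemma energy_cong: "(\<And>x. x \<in> I \<Longrightarrow> \<psi> x = r x) \<Longrightarrow> energy c \<psi> = energy c r"
  unfolding energy_def by (auto intro!: sum.cong arg_cong2[where f = "(-)"])

lemma energy_oper: "energy c r = (\<Sum>x\<in>I. r x * oper c r x) / 2"
  unfolding energy_def oper_def
  by (simp add: right_diff_distrib sum_subtractf sum_distrib_left power2_eq_square mult_ac diff_divide_distrib)

lemma double_sum_sym: "(\<Sum>x\<in>I. \<Sum>y\<in>I. w x y * r x * \<psi> y) = (\<Sum>x\<in>I. \<Sum>y\<in>I. w x y * \<psi> x * r y)"
proof -
  have "(\<Sum>x\<in>I. \<Sum>y\<in>I. w x y * r x * \<psi> y) = (\<Sum>y\<in>I. \<Sum>x\<in>I. w x y * r x * \<psi> y)"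
    by (rule sum.swap)
  also have "\<dots> = (\<Sum>y\<in>I. \<Sum>x\<in>I. w y x * \<psi> y * r x)"
    by (intro sum.cong refl) (simp add: sym)
  finally show ?thesis .
qed

text \<open>When \<open>r\<close> is the Green function of \<open>x\<close>, the linear term reduces
  to \<open>\<psi> x\<close>, so such a shift changes the energy by a function of one
  coordinate.\<close>

lemma energy_shift:
  "energy c (\<lambda>x. \<psi> x + t * r x) = energy c \<psi> + t * (\<Sum>x\<in>I. \<psi> x * oper c r x) + t\<^sup>2 * energy c r"
proof -
  have 1: "(\<Sum>x\<in>I. (1 + c x) * (\<psi> x + t * r x)\<^sup>2) = (\<Sum>x\<in>I. (1 + c x) * (\<psi> x)\<^sup>2)
    + 2 * t * (\<Sum>x\<in>I. (1 + c x) * \<psi> x * r x) + t\<^sup>2 * (\<Sum>x\<in>I. (1 + c x) * (r x)\<^sup>2)"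
    unfolding sum_distrib_left sum.distrib[symmetric]
    by (intro sum.cong refl) (simp add: power2_eq_square algebra_simps)
  have 2: "(\<Sum>x\<in>I. \<Sum>y\<in>I. w x y * (\<psi> x + t * r x) * (\<psi> y + t * r y)) =
     (\<Sum>x\<in>I. \<Sum>y\<in>I. w x y * \<psi> x * \<psi> y) + t * (\<Sum>x\<in>I. \<Sum>y\<in>I. w x y * \<psi> x * r y)
     + t * (\<Sum>x\<in>I. \<Sum>y\<in>I. w x y * r x * \<psi> y) + t\<^sup>2 * (\<Sum>x\<in>I. \<Sum>y\<in>I. w x y * r x * r y)"
    unfolding sum_distrib_left sum.distrib[symmetric]
    by (intro sum.cong refl) (simp add: power2_eq_square algebra_simps)
  have 3: "(\<Sum>x\<in>I. \<psi> x * oper c r x) = (\<Sum>x\<in>I. (1 + c x) * \<psi> x * r x) - (\<Sum>x\<in>I. \<Sum>y\<in>I. w x y * \<psi> x * r y)"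
    unfolding oper_def right_diff_distrib sum_subtractf sum_distrib_left by (simp add: mult_ac)
  show ?thesis
    unfolding energy_def 1 2 double_sum_sym[of r \<psi>] 3 by (simp add: field_simps)
qed

text \<open>Summation by parts into a Dirichlet form, in which every term is nonnegative as soon as
  \<open>c\<close> is.\<close>

lemma energy_eq_killing:
  "energy c \<psi> = (\<Sum>x\<in>I. (killing x + c x) * (\<psi> x)\<^sup>2) / 2 + (\<Sum>x\<in>I. \<Sum>y\<in>I. w x y * (\<psi> x - \<psi> y)\<^sup>2) / 4"
proof -
  have a: "(\<Sum>x\<in>I. \<Sum>y\<in>I. w x y * (\<psi> y)\<^sup>2) = (\<Sum>x\<in>I. \<Sum>y\<in>I. w x y * (\<psi> x)\<^sup>2)"
    using double_sum_sym[of "\<lambda>_. 1" "\<lambda>x. (\<psi> x)\<^sup>2"] by simp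
  have b: "(\<Sum>x\<in>I. \<Sum>y\<in>I. w x y * (\<psi> x - \<psi> y)\<^sup>2) = (\<Sum>x\<in>I. \<Sum>y\<in>I. w x y * (\<psi> x)\<^sup>2)
      + (\<Sum>x\<in>I. \<Sum>y\<in>I. w x y * (\<psi> y)\<^sup>2) - 2 * (\<Sum>x\<in>I. \<Sum>y\<in>I. w x y * \<psi> x * \<psi> y)"
    unfolding sum_distrib_left sum.distrib[symmetric] sum_subtractf[symmetric]
    by (intro sum.cong refl) (simp add: power2_eq_square algebra_simps)
  have c: "(\<Sum>x\<in>I. (killing x + c x) * (\<psi> x)\<^sup>2) = (\<Sum>x\<in>I. (1 + c x) * (\<psi> x)\<^sup>2) - (\<Sum>x\<in>I. \<Sum>y\<in>I. w x y * (\<psi> x)\<^sup>2)"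
    unfolding sum_subtractf[symmetric] killing_def
    by (intro sum.cong refl) (simp add: algebra_simps sum_distrib_left sum_distrib_right)
  show ?thesis unfolding energy_def b a c by (simp add: field_simps)
qed

lemma energy_nonneg:
  assumes "\<And>x. x \<in> I \<Longrightarrow> 0 \<le> c x"
  shows "0 \<le> energy c \<psi>"
  unfolding energy_eq_killing
  by (intro add_nonneg_nonneg divide_nonneg_pos sum_nonneg mult_nonneg_nonneg) (auto simp: killing_bounds assms nonneg)

text \<open>Monotone iteration from zero, bounded by the supersolution \<open>f\<close>; the limit
  is the Green function. Since \<open>f\<close> stays a supersolution for every nonnegative mass,
  the bound \<open>K\<close> is independent of \<open>c\<close>.\<close>

lemma green_exists:
  assumes c: "\<And>y. y \<in> I \<Longrightarrow> 0 \<le> c y" and x: "x \<in> I"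
  shows "\<exists>g. (\<forall>y\<in>I. 0 \<le> g y) \<and> (\<forall>y\<in>I. oper c g y = (if y = x then 1 else 0)) \<and> 0 < g x \<and> g x \<le> K"
proof -
  obtain f where f0: "\<And>y. y \<in> I \<Longrightarrow> 0 \<le> f y"
    and f: "\<And>y. y \<in> I \<Longrightarrow> (\<Sum>z\<in>I. w y z * f z) + (if y = x then 1 else 0) \<le> f y" and fK: "f x \<le> K"
    using supersolution[OF x] by blast
  \<comment> \<open>A fixed point of \<open>T\<close> is a solution of the Green equation, solved
    for the term \<open>(1 + c y) * g y\<close>.\<close>
  define T where "T = (\<lambda>g y. ((if y = x then 1 else 0) + (\<Sum>z\<in>I. w y z * g z)) / (1 + c y))"
  define G where "G = (\<lambda>k. (T ^^ k) (\<lambda>_. 0))"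
  have G0: "G 0 = (\<lambda>_. 0)" and GS: "G (Suc k) = T (G k)" for k by (auto simp: G_def)
  have Tmono: "T g y \<le> T h y" if "\<And>z. z \<in> I \<Longrightarrow> g z \<le> h z" "y \<in> I" for g h y
    unfolding T_def using that c[of y]
    by (intro divide_right_mono add_left_mono sum_mono mult_left_mono) (auto simp: nonneg)
  have inc: "\<forall>y\<in>I. G k y \<le> G (Suc k) y" for k
  proof (induction k)
    case 0
    show ?case using c by (auto simp: GS G0 T_def)
  next
    case (Suc k)
    then show ?case using Tmono[of "G k" "G (Suc k)"] by (simp only: GS) auto
  qed
  have Tf: "T f y \<le> f y" if y: "y \<in> I" for y
  proof -
    have "f y * 1 \<le> f y * (1 + c y)" using f0[OF y] c[OF y] by (intro mult_left_mono) auto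
    then show ?thesis using f[OF y] c[OF y] unfolding T_def by (subst pos_divide_le_eq) auto
  qed
  have le: "\<forall>y\<in>I. G k y \<le> f y" for k
  proof (induction k)
    case 0 then show ?case by (simp add: G0 f0)
  next
    case (Suc k)
    then have "T (G k) y \<le> T f y" if "y \<in> I" for y using Tmono[of "G k" f y] that by auto
    then show ?case using Tf by (force simp: GS)
  qed
  have conv: "\<exists>l. (\<lambda>k. G k y) \<longlonglongrightarrow> l" if "y \<in> I" for y
    using incseq_convergent[of "\<lambda>k. G k y" "f y"] inc le that by (metis incseq_SucI)
  then obtain g where g: "\<And>y. y \<in> I \<Longrightarrow> (\<lambda>k. G k y) \<longlonglongrightarrow> g y" by metis
  have gT: "g y = T g y" if y: "y \<in> I" for y
  proof -
    have "(\<lambda>k. G (Suc k) y) \<longlonglongrightarrow> g y" using g[OF y] by (rule LIMSEQ_Suc)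
    moreover have "(\<lambda>k. T (G k) y) \<longlonglongrightarrow> T g y"
      unfolding T_def using g c[OF y] by (intro tendsto_intros) auto
    ultimately show ?thesis unfolding GS using LIMSEQ_unique by blast
  qed
  have g0: "0 \<le> g y" if y: "y \<in> I" for y
  proof (rule LIMSEQ_le_const[OF g[OF y]])
    have "0 \<le> G k y" for k
      by (induction k) (use G0 inc y in \<open>auto intro: order_trans\<close>)
    then show "\<exists>N. \<forall>k\<ge>N. 0 \<le> G k y" by auto
  qed
  have gf: "g y \<le> f y" if y: "y \<in> I" for y
    using LIMSEQ_le_const2[OF g[OF y], of "f y"] le y by auto
  have op: "oper c g y = (if y = x then 1 else 0)" if "y \<in> I" for y
  proof -
    have "(1 + c y) * g y = (1 + c y) * T g y" using gT[OF that] by (rule arg_cong)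
    also have "\<dots> = (if y = x then 1 else 0) + (\<Sum>z\<in>I. w y z * g z)"
      using c[OF that] unfolding T_def by (subst times_divide_eq_right, subst nonzero_mult_div_cancel_left) auto
    finally show ?thesis by (simp add: oper_def)
  qed
  have "0 \<le> (\<Sum>z\<in>I. w x z * g z)"
    using g0 nonneg x by (intro sum_nonneg mult_nonneg_nonneg) auto
  then have "0 < (1 + c x) * g x" using op[OF x] by (simp add: oper_def)
  then have "0 < g x" using g0[OF x] c[OF x] by (simp add: zero_less_mult_iff)
  moreover have "g x \<le> K" using gf[OF x] fK by simp
  ultimately show ?thesis using g0 op by blast
qed

lemma K_pos: "0 < K"
proof -
  obtain x where x: "x \<in> I" using nonempty by auto
  obtain g where "0 < g x" "g x \<le> K" using green_exists[of "\<lambda>_. 0" x] x by auto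
  then show ?thesis by simp
qed

lemma sum_mult_oper_green:
  assumes "\<forall>y\<in>I. oper c g y = (if y = x then 1 else 0)" "x \<in> I"
  shows "(\<Sum>y\<in>I. \<psi> y * oper c g y) = \<psi> x"
proof -
  have "(\<Sum>y\<in>I. \<psi> y * oper c g y) = (\<Sum>y\<in>I. if y = x then \<psi> y else 0)"
    using assms by (intro sum.cong) auto
  then show ?thesis using fin assms(2) by simp
qed

text \<open>The energy is nonnegative along the line through \<open>\<psi>\<close> in the direction
  of the Green function of \<open>x\<close>; the minimising \<open>t\<close> gives the bound.
  Probabilistically, variances are at most \<open>K\<close>, whatever the mass.\<close>

lemma energy_coercive:
  assumes c: "\<And>y. y \<in> I \<Longrightarrow> 0 \<le> c y" and x: "x \<in> I"
  shows "(\<psi> x)\<^sup>2 / (2 * K) \<le> energy c \<psi>"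
proof -
  obtain g where g: "\<forall>y\<in>I. oper c g y = (if y = x then 1 else 0)" "0 < g x" "g x \<le> K"
    using green_exists[where c = c, OF c x] by auto
  have Eg: "energy c g = g x / 2"
    unfolding energy_oper sum_mult_oper_green[OF g(1) x] by simp
  have s: "(\<Sum>y\<in>I. \<psi> y * oper c g y) = \<psi> x"
    by (rule sum_mult_oper_green[OF g(1) x])
  define t where "t = - \<psi> x / g x"
  have "0 \<le> energy c \<psi> + (t * \<psi> x + t\<^sup>2 * (g x / 2))"
    using energy_nonneg[of c "\<lambda>y. \<psi> y + t * g y"] c unfolding energy_shift s Eg by simp
  also have "t * \<psi> x + t\<^sup>2 * (g x / 2) = - ((\<psi> x)\<^sup>2 / (2 * g x))"
    unfolding t_def using g(2) by (simp add: field_simps power2_eq_square)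
  finally have "(\<psi> x)\<^sup>2 / (2 * g x) \<le> energy c \<psi>" by simp
  moreover have "(\<psi> x)\<^sup>2 / (2 * K) \<le> (\<psi> x)\<^sup>2 / (2 * g x)"
    using g by (intro divide_left_mono) auto
  ultimately show ?thesis by linarith
qed

section \<open>Gibbs measures\<close>

definition leb :: "('i \<Rightarrow> real) measure" where
  "leb = PiM I (\<lambda>_. lborel)"

definition shift :: "('i \<Rightarrow> real) \<Rightarrow> ('i \<Rightarrow> real) \<Rightarrow> 'i \<Rightarrow> real" where
  "shift v \<psi> = (\<lambda>x\<in>I. \<psi> x + v x)"

definition gibbs :: "('i \<Rightarrow> real) \<Rightarrow> ('i \<Rightarrow> real) measure" where
  "gibbs c = density leb (\<lambda>\<psi>. ennreal (exp (- energy c \<psi>)))"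

lemma measurable_leb_component [measurable]: "x \<in> I \<Longrightarrow> (\<lambda>\<psi>. \<psi> x) \<in> borel_measurable leb"
  unfolding leb_def using measurable_component_singleton[of x I "\<lambda>_. lborel :: real measure"] by simp

lemma measurable_shift [measurable]: "shift v \<in> measurable leb leb"
  unfolding shift_def by (subst (2) leb_def, rule measurable_restrict) simp

lemma shift_apply [simp]: "x \<in> I \<Longrightarrow> shift v \<psi> x = \<psi> x + v x"
  by (simp add: shift_def)

text \<open>Checked on rectangles, where it reduces to translation invariance of Lebesgue measure in
  each coordinate.\<close>

lemma distr_shift: "distr leb leb (shift v) = leb"
proof -
  interpret product_sigma_finite "\<lambda>_::'i. lborel :: real measure" by standard
  show ?thesis
    unfolding leb_def
  proof (rule PiM_eqI[OF fin])
    fix A :: "'i \<Rightarrow> real set" assume "\<And>i. i \<in> I \<Longrightarrow> A i \<in> sets lborel"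
    then have A: "\<And>i. i \<in> I \<Longrightarrow> A i \<in> sets borel" by simp
    have B: "(\<lambda>y. v i + y) -` A i \<in> sets borel" if "i \<in> I" for i
      using measurable_sets[of "\<lambda>y. v i + y" borel borel "A i"] A[OF that] by simp
    have eq: "shift v -` Pi\<^sub>E I A \<inter> space (PiM I (\<lambda>_. lborel)) = Pi\<^sub>E I (\<lambda>i. (\<lambda>y. v i + y) -` A i)"
      by (auto simp: space_PiM PiE_iff shift_def add.commute extensional_def)
    have em: "emeasure lborel ((\<lambda>y. v i + y) -` A i) = emeasure lborel (A i)" if "i \<in> I" for i
      using emeasure_distr[of "\<lambda>y. v i + y" lborel borel "A i"] A[OF that]
      by (simp add: lborel_distr_plus)
    have "emeasure (distr (PiM I (\<lambda>_. lborel)) (PiM I (\<lambda>_. lborel)) (shift v)) (Pi\<^sub>E I A)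
       = emeasure (PiM I (\<lambda>_. lborel)) (Pi\<^sub>E I (\<lambda>i. (\<lambda>y. v i + y) -` A i))"
      using A fin measurable_shift[of v] unfolding leb_def
      by (subst emeasure_distr) (auto simp: eq intro!: sets_PiM_I_finite)
    also have "\<dots> = (\<Prod>i\<in>I. emeasure lborel (A i))"
      using B em by (subst emeasure_PiM) (auto simp: fin)
    finally show "emeasure (distr (PiM I (\<lambda>_. lborel)) (PiM I (\<lambda>_. lborel)) (shift v)) (Pi\<^sub>E I A)
       = (\<Prod>i\<in>I. emeasure lborel (A i))" .
  qed simp
qed

lemma measurable_energy [measurable]: "energy c \<in> borel_measurable leb"
  unfolding energy_def by measurable

lemma integrable_gaussian:
  assumes "0 < e" shows "integrable lborel (\<lambda>y::real. exp (- e * y\<^sup>2))"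
proof -
  define s where "s = sqrt (1 / (2 * e))"
  have s: "s > 0" "s\<^sup>2 = 1 / (2 * e)" using assms by (auto simp: s_def)
  have "integrable lborel (\<lambda>y. sqrt (2 * pi * s\<^sup>2) * normal_density 0 s y)"
    using s by (intro integrable_mult_right) simp
  also have "(\<lambda>y. sqrt (2 * pi * s\<^sup>2) * normal_density 0 s y) = (\<lambda>y. exp (- e * y\<^sup>2))"
    using assms by (auto simp: normal_density_def fun_eq_iff s(2))
  finally show ?thesis .
qed

text \<open>Averaging \<open>energy_coercive\<close> over the sites dominates the weight by a
  product of one-dimensional Gaussians; hence the factor \<open>card I\<close> in
  \<open>e\<close>.\<close>

lemma integrable_exp_energy:
  assumes c: "\<And>y. y \<in> I \<Longrightarrow> 0 \<le> c y"
  shows "integrable leb (\<lambda>\<psi>. exp (- energy c \<psi>))"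
proof -
  interpret product_sigma_finite "\<lambda>_::'i. lborel :: real measure" by standard
  define e where "e = 1 / (2 * K * card I)"
  have n: "card I > 0" using fin nonempty by (simp add: card_gt_0_iff)
  have e: "e > 0" using K_pos n by (simp add: e_def)
  have "integrable leb (\<lambda>\<psi>. \<Prod>x\<in>I. exp (- e * (\<psi> x)\<^sup>2))"
    unfolding leb_def by (rule product_integrable_prod[OF fin]) (rule integrable_gaussian[OF e])
  then show ?thesis
  proof (rule Bochner_Integration.integrable_bound)
    show "AE \<psi> in leb. norm (exp (- energy c \<psi>)) \<le> norm (\<Prod>x\<in>I. exp (- e * (\<psi> x)\<^sup>2))"
    proof (rule AE_I2)
      fix \<psi>
      have "(\<Sum>x\<in>I. e * (\<psi> x)\<^sup>2) \<le> (\<Sum>x\<in>I. energy c \<psi> / card I)"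
      proof (rule sum_mono)
        fix x assume "x \<in> I"
        then have "(\<psi> x)\<^sup>2 / (2 * K) \<le> energy c \<psi>" using energy_coercive c by blast
        then have "(\<psi> x)\<^sup>2 / (2 * K) / card I \<le> energy c \<psi> / card I" by (rule divide_right_mono) simp
        then show "e * (\<psi> x)\<^sup>2 \<le> energy c \<psi> / card I" by (simp add: e_def)
      qed
      then have "(\<Sum>x\<in>I. e * (\<psi> x)\<^sup>2) \<le> energy c \<psi>" using n by simp
      then show "norm (exp (- energy c \<psi>)) \<le> norm (\<Prod>x\<in>I. exp (- e * (\<psi> x)\<^sup>2))"
        by (simp add: exp_sum[OF fin, symmetric] sum_negf)
    qed
  qed simp
qed

lemma sets_gibbs [simp, measurable_cong]: "sets (gibbs c) = sets leb"
  and space_gibbs [simp]: "space (gibbs c) = space leb"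
  by (auto simp: gibbs_def)

lemma energy_shift': "energy c (shift (\<lambda>x. t * r x) \<psi>)
  = energy c \<psi> + t * (\<Sum>x\<in>I. \<psi> x * oper c r x) + t\<^sup>2 * energy c r"
  unfolding energy_shift[symmetric] by (rule energy_cong) simp

text \<open>Change of variables by a translation. All lifting and lowering arguments rest on this
  estimate; a negative \<open>\<gamma>\<close> means that the shift costs energy.\<close>

lemma emeasure_gibbs_shift:
  assumes A: "A \<in> sets leb" and B: "B \<in> sets leb"
    and step: "\<And>\<psi>. \<psi> \<in> A \<Longrightarrow> shift v \<psi> \<in> B \<and> energy c (shift v \<psi>) \<le> energy c \<psi> - \<gamma>"
  shows "ennreal (exp \<gamma>) * emeasure (gibbs c) A \<le> emeasure (gibbs c) B"
proof -
  let ?f = "\<lambda>\<psi>. ennreal (exp (- energy c \<psi>)) * indicator B \<psi>"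
  have m: "?f \<in> borel_measurable leb" using B by measurable
  have "emeasure (gibbs c) B = (\<integral>\<^sup>+\<psi>. ?f \<psi> \<partial>leb)"
    unfolding gibbs_def using B by (subst emeasure_density) auto
  also have "\<dots> = (\<integral>\<^sup>+\<psi>. ?f \<psi> \<partial>distr leb leb (shift v))" by (simp only: distr_shift)
  also have "\<dots> = (\<integral>\<^sup>+\<psi>. ?f (shift v \<psi>) \<partial>leb)"
    by (rule nn_integral_distr) (use m in auto)
  also have "\<dots> \<ge> (\<integral>\<^sup>+\<psi>. ennreal (exp \<gamma>) * (ennreal (exp (- energy c \<psi>)) * indicator A \<psi>) \<partial>leb)"
  proof (rule nn_integral_mono)
    fix \<psi>
    show "ennreal (exp \<gamma>) * (ennreal (exp (- energy c \<psi>)) * indicator A \<psi>) \<le> ?f (shift v \<psi>)"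
    proof (cases "\<psi> \<in> A")
      case True
      then have "exp \<gamma> * exp (- energy c \<psi>) \<le> exp (- energy c (shift v \<psi>))"
        using step[OF True] by (simp add: exp_add[symmetric])
      then show ?thesis using step[OF True] True by (simp add: ennreal_mult[symmetric])
    qed simp
  qed
  also have "(\<integral>\<^sup>+\<psi>. ennreal (exp \<gamma>) * (ennreal (exp (- energy c \<psi>)) * indicator A \<psi>) \<partial>leb)
    = ennreal (exp \<gamma>) * emeasure (gibbs c) A"
    unfolding gibbs_def using A by (subst nn_integral_cmult) (auto simp: emeasure_density)
  finally show ?thesis .
qed

lemma finite_measure_gibbs:
  assumes c: "\<And>y. y \<in> I \<Longrightarrow> 0 \<le> c y"
  shows "finite_measure (gibbs c)"
proof
  have "emeasure (gibbs c) (space leb) = (\<integral>\<^sup>+\<psi>. ennreal (exp (- energy c \<psi>)) \<partial>leb)"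
    unfolding gibbs_def by (subst emeasure_density) (auto intro!: nn_integral_cong)
  also have "\<dots> = ennreal (\<integral>\<psi>. exp (- energy c \<psi>) \<partial>leb)"
    using c by (intro nn_integral_eq_integral integrable_exp_energy) auto
  finally show "emeasure (gibbs c) (space (gibbs c)) \<noteq> \<infinity>" by simp
qed

lemma measure_gibbs_shift:
  assumes c: "\<And>y. y \<in> I \<Longrightarrow> 0 \<le> c y"
    and A: "A \<in> sets leb" and B: "B \<in> sets leb"
    and step: "\<And>\<psi>. \<psi> \<in> A \<Longrightarrow> shift v \<psi> \<in> B \<and> energy c (shift v \<psi>) \<le> energy c \<psi> - \<gamma>"
  shows "exp \<gamma> * measure (gibbs c) A \<le> measure (gibbs c) B"
proof -
  interpret finite_measure "gibbs c" using c by (rule finite_measure_gibbs)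
  show ?thesis
    using emeasure_gibbs_shift[OF A B step] by (simp add: emeasure_eq_measure ennreal_mult'[symmetric])
qed

text \<open>Completing the square: the linear term minus the energy of \<open>\<psi>\<close> equals
  the energy of \<open>r\<close> minus that of \<open>\<psi> - r\<close>. Translation invariance
  then removes \<open>r\<close>.\<close>

lemma gibbs_mgf:
  assumes c: "\<And>y. y \<in> I \<Longrightarrow> 0 \<le> c y"
  shows "has_bochner_integral (gibbs c) (\<lambda>\<psi>. exp (\<Sum>x\<in>I. \<psi> x * oper c r x))
    (exp (energy c r) * measure (gibbs c) (space leb))"
proof -
  let ?s = "shift (\<lambda>x. (-1) * r x)"
  have int: "integrable leb (\<lambda>\<psi>. exp (- energy c \<psi>))" using integrable_exp_energy c by blast
  have mass: "measure (gibbs c) (space leb) = (\<integral>\<psi>. exp (- energy c \<psi>) \<partial>leb)"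
  proof -
    interpret finite_measure "gibbs c" using c by (rule finite_measure_gibbs)
    have "emeasure (gibbs c) (space leb) = (\<integral>\<^sup>+\<psi>. ennreal (exp (- energy c \<psi>)) \<partial>leb)"
      unfolding gibbs_def by (subst emeasure_density) (auto intro!: nn_integral_cong)
    also have "\<dots> = ennreal (\<integral>\<psi>. exp (- energy c \<psi>) \<partial>leb)"
      using int by (intro nn_integral_eq_integral) auto
    finally show ?thesis by (simp add: emeasure_eq_measure)
  qed
  have "has_bochner_integral (distr leb leb ?s) (\<lambda>\<psi>. exp (- energy c \<psi>)) (measure (gibbs c) (space leb))"
    unfolding distr_shift mass using int by (rule has_bochner_integral_integrable)
  then have "has_bochner_integral leb (\<lambda>\<psi>. exp (- energy c (?s \<psi>))) (measure (gibbs c) (space leb))"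
    by (subst (asm) has_bochner_integral_iff, simp add: has_bochner_integral_iff integrable_distr_eq integral_distr)
  then have "has_bochner_integral leb (\<lambda>\<psi>. exp (energy c r) * exp (- energy c (?s \<psi>)))
      (exp (energy c r) * measure (gibbs c) (space leb))"
    by (rule has_bochner_integral_mult_right)
  moreover have "exp (energy c r) * exp (- energy c (?s \<psi>)) = exp (- energy c \<psi>) *\<^sub>R exp (\<Sum>x\<in>I. \<psi> x * oper c r x)" for \<psi>
    unfolding energy_shift' by (simp add: exp_add[symmetric])
  ultimately show ?thesis
    unfolding gibbs_def
    by (intro has_bochner_integral_density) (auto simp: oper_def)
qed

end

section \<open>Jensen's inequality and exponential moments\<close>

text \<open>Jensen's inequality conditioned on \<open>A\<close>, obtained by integrating the tangent
  line of \<open>exp\<close> at the conditional mean \<open>c\<close>.\<close>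

lemma measure_exp_mean_le:
  fixes Y :: "'a \<Rightarrow> real"
  assumes "finite_measure N" and A: "A \<in> sets N" and pos: "0 < measure N A"
    and Y: "integrable N (\<lambda>x. indicator A x * Y x)" and eY: "integrable N (\<lambda>x. indicator A x * exp (Y x))"
  shows "measure N A * exp ((\<integral>x. indicator A x * Y x \<partial>N) / measure N A) \<le> (\<integral>x. indicator A x * exp (Y x) \<partial>N)"
proof -
  interpret finite_measure N by fact
  define c where "c = (\<integral>x. indicator A x * Y x \<partial>N) / measure N A"
  have iA: "integrable N (\<lambda>x. indicator A x :: real)" using A by (simp add: emeasure_eq_measure)
  have "(\<integral>x. exp c * (1 - c) * indicator A x + exp c * (indicator A x * Y x) \<partial>N) \<le> (\<integral>x. indicator A x * exp (Y x) \<partial>N)"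
  proof (rule integral_mono)
    fix x
    have "exp c * (1 + (Y x - c)) \<le> exp c * exp (Y x - c)"
      by (intro mult_left_mono exp_ge_add_one_self) auto
    then have "exp c * (1 - c) + exp c * Y x \<le> exp (Y x)"
      by (simp add: exp_add[symmetric] algebra_simps)
    then show "exp c * (1 - c) * indicator A x + exp c * (indicator A x * Y x) \<le> indicator A x * exp (Y x)"
      by (auto simp: indicator_def)
  qed (use iA Y eY in auto)
  also have "(\<integral>x. exp c * (1 - c) * indicator A x + exp c * (indicator A x * Y x) \<partial>N)
    = exp c * (1 - c) * measure N A + exp c * (\<integral>x. indicator A x * Y x \<partial>N)"
    using iA Y A sets.sets_into_space[OF A] by (subst Bochner_Integration.integral_add) (auto simp: Int_absorb2)
  also have "\<dots> = measure N A * exp c" using pos by (simp add: c_def field_simps)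
  finally show ?thesis by (simp add: c_def)
qed

lemma square_le_exp: "y\<^sup>2 \<le> 2 * (exp y + exp (- y))" for y :: real
proof -
  have *: "y\<^sup>2 \<le> 2 * exp y" if "0 \<le> y" for y :: real
    using exp_lower_Taylor_quadratic[OF that] that by simp
  show ?thesis
    using *[of y] *[of "- y"] by (cases "0 \<le> y") (auto intro: order_trans simp: add_increasing add_increasing2 distrib_left)
qed

context substochastic_kernel
begin

text \<open>This is \<open>gibbs_mgf\<close> with \<open>r\<close> equal to \<open>s\<close> times
  the Green function of \<open>x\<close>: the linear term becomes \<open>s * \<psi> x\<close>, and
  the energy of \<open>r\<close> is \<open>g x / 2\<close>, at most \<open>K / 2\<close>.\<close>

lemma exp_coordinate:
  assumes x: "x \<in> I" and c: "\<And>y. y \<in> I \<Longrightarrow> 0 \<le> c y" and s: "\<bar>s\<bar> = 1"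
  shows "integrable (gibbs c) (\<lambda>\<psi>. exp (s * \<psi> x))"
    and "(\<integral>\<psi>. exp (s * \<psi> x) \<partial>gibbs c) \<le> exp (K / 2) * measure (gibbs c) (space leb)"
proof -
  obtain g where g: "\<forall>y\<in>I. oper c g y = (if y = x then 1 else 0)" "g x \<le> K"
    using green_exists[where c = c, OF c x] by auto
  have s2: "s * s = 1" using s by (metis abs_mult_self_eq mult_1)
  have op: "oper c (\<lambda>y. s * g y) y = s * oper c g y" for y
    unfolding oper_def by (simp add: sum_distrib_left algebra_simps)
  have sum: "(\<Sum>y\<in>I. \<psi> y * oper c (\<lambda>y. s * g y) y) = s * \<psi> x" for \<psi>
  proof -
    have "(\<Sum>y\<in>I. \<psi> y * oper c (\<lambda>y. s * g y) y) = s * (\<Sum>y\<in>I. \<psi> y * oper c g y)"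
      unfolding op sum_distrib_left by (intro sum.cong) auto
    then show ?thesis unfolding sum_mult_oper_green[OF g(1) x] .
  qed
  have E: "energy c (\<lambda>y. s * g y) = g x / 2"
    unfolding energy_oper sum using s2 by simp
  have "has_bochner_integral (gibbs c) (\<lambda>\<psi>. exp (s * \<psi> x)) (exp (g x / 2) * measure (gibbs c) (space leb))"
    using gibbs_mgf[of c "\<lambda>y. s * g y"] c unfolding sum E by auto
  then show "integrable (gibbs c) (\<lambda>\<psi>. exp (s * \<psi> x))"
    and "(\<integral>\<psi>. exp (s * \<psi> x) \<partial>gibbs c) \<le> exp (K / 2) * measure (gibbs c) (space leb)"
    using g(2) by (auto simp: has_bochner_integral_iff intro!: mult_right_mono)
qed

lemma second_moment:
  assumes x: "x \<in> I" and c: "\<And>y. y \<in> I \<Longrightarrow> 0 \<le> c y"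
  shows "integrable (gibbs c) (\<lambda>\<psi>. (\<psi> x)\<^sup>2)"
    and "(\<integral>\<psi>. (\<psi> x)\<^sup>2 \<partial>gibbs c) \<le> 4 * exp (K / 2) * measure (gibbs c) (space leb)"
proof -
  have i: "integrable (gibbs c) (\<lambda>\<psi>. 2 * (exp (\<psi> x) + exp (- \<psi> x)))"
    and b: "(\<integral>\<psi>. 2 * (exp (\<psi> x) + exp (- \<psi> x)) \<partial>gibbs c) \<le> 4 * exp (K / 2) * measure (gibbs c) (space leb)"
    using exp_coordinate[of x c 1, OF x c] exp_coordinate[of x c "-1", OF x c]
    by (auto simp: Bochner_Integration.integral_add)
  show j: "integrable (gibbs c) (\<lambda>\<psi>. (\<psi> x)\<^sup>2)"
    by (rule Bochner_Integration.integrable_bound[OF i]) (use x square_le_exp in \<open>auto intro: order_trans\<close>)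
  have "(\<integral>\<psi>. (\<psi> x)\<^sup>2 \<partial>gibbs c) \<le> (\<integral>\<psi>. 2 * (exp (\<psi> x) + exp (- \<psi> x)) \<partial>gibbs c)"
    by (rule integral_mono[OF j i]) (rule square_le_exp)
  then show "(\<integral>\<psi>. (\<psi> x)\<^sup>2 \<partial>gibbs c) \<le> 4 * exp (K / 2) * measure (gibbs c) (space leb)"
    using b by linarith
qed

lemma integrable_coordinate:
  assumes x: "x \<in> I" and c: "\<And>y. y \<in> I \<Longrightarrow> 0 \<le> c y"
  shows "integrable (gibbs c) (\<lambda>\<psi>. \<psi> x)"
proof -
  interpret finite_measure "gibbs c" using c by (rule finite_measure_gibbs)
  have "integrable (gibbs c) (\<lambda>\<psi>. 1 + (\<psi> x)\<^sup>2)" using second_moment(1)[of x c] x c by auto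
  then show ?thesis
  proof (rule Bochner_Integration.integrable_bound)
    show "AE \<psi> in gibbs c. norm (\<psi> x) \<le> norm (1 + (\<psi> x)\<^sup>2)"
    proof (rule AE_I2)
      fix \<psi> :: "'i \<Rightarrow> real"
      have "0 \<le> (\<bar>\<psi> x\<bar> - 1)\<^sup>2" by simp
      then have "2 * \<bar>\<psi> x\<bar> \<le> 1 + (\<psi> x)\<^sup>2" by (simp add: power2_eq_square algebra_simps abs_mult_self_eq)
      then show "norm (\<psi> x) \<le> norm (1 + (\<psi> x)\<^sup>2)" by auto
    qed
  qed (use x in auto)
qed

section \<open>Partition functions with wall and pinning\<close>

definition Z :: "('i \<Rightarrow> real) \<Rightarrow> real" where
  "Z c = measure (gibbs c) (space leb)"

text \<open>Heights are measured from \<open>u\<close>: this is positivity of the field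
  \<open>\<psi> + u\<close>. Its contact window accordingly becomes \<open>{- u..- u + a}\<close>
  below.\<close>

definition above :: "real \<Rightarrow> ('i \<Rightarrow> real) set" where
  "above u = {\<psi> \<in> space leb. \<forall>x\<in>I. - u \<le> \<psi> x}"

lemma sets_above [measurable]: "above u \<in> sets leb"
proof -
  have "above u = (\<Inter>x\<in>I. {\<psi> \<in> space leb. - u \<le> \<psi> x})" using nonempty by (auto simp: above_def)
  also have "\<dots> \<in> sets leb" using fin nonempty by (intro sets.finite_INT) auto
  finally show ?thesis .
qed

text \<open>The unit cube lies in \<open>above u\<close> and the density is positive
  everywhere.\<close>

lemma measure_above_pos:
  assumes u: "0 \<le> u" and c: "\<And>y. y \<in> I \<Longrightarrow> 0 \<le> c y"
  shows "0 < measure (gibbs c) (above u)"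
proof -
  interpret finite_measure "gibbs c" using c by (rule finite_measure_gibbs)
  interpret product_sigma_finite "\<lambda>_::'i. lborel :: real measure" by standard
  have "emeasure leb (Pi\<^sub>E I (\<lambda>_. {0..1})) = 1"
    unfolding leb_def by (subst emeasure_PiM) (auto simp: fin)
  moreover have "emeasure leb (Pi\<^sub>E I (\<lambda>_. {0..1})) \<le> emeasure leb (above u)"
  proof (rule emeasure_mono)
    have "- u \<le> r" if "0 \<le> r" for r :: real using that u by linarith
    then show "Pi\<^sub>E I (\<lambda>_. {0..1}) \<subseteq> above u"
      by (auto simp: above_def leb_def space_PiM PiE_iff)
  qed measurable
  ultimately have ne: "emeasure leb (above u) \<noteq> 0" by auto
  have "emeasure (gibbs c) (above u) \<noteq> 0"
  proof
    assume "emeasure (gibbs c) (above u) = 0"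
    then have "above u \<in> null_sets (density leb (\<lambda>\<psi>. ennreal (exp (- energy c \<psi>))))"
      by (auto simp: null_sets_def gibbs_def)
    then have "AE \<psi> in leb. \<psi> \<in> above u \<longrightarrow> ennreal (exp (- energy c \<psi>)) = 0"
      by (subst (asm) null_sets_density_iff) auto
    then have "AE \<psi> in leb. \<psi> \<notin> above u" by (rule AE_mp) simp
    moreover have "{\<psi> \<in> space leb. \<not> \<psi> \<notin> above u} = above u" by (auto simp: above_def)
    ultimately have "emeasure leb (above u) = 0"
      using AE_iff_measurable[OF sets_above[of u], of "\<lambda>\<psi>. \<psi> \<notin> above u"] by simp
    then show False using ne by simp
  qed
  then show ?thesis by (simp add: emeasure_eq_measure less_le)
qed

lemma measure_above_le_Z:
  assumes c: "\<And>y. y \<in> I \<Longrightarrow> 0 \<le> c y"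
  shows "measure (gibbs c) (above u) \<le> Z c"
proof -
  interpret finite_measure "gibbs c" using c by (rule finite_measure_gibbs)
  show ?thesis unfolding Z_def using bounded_measure[of "above u"] by simp
qed

lemma Z_pos: 
  assumes c: "\<And>y. y \<in> I \<Longrightarrow> 0 \<le> c y"
  shows "0 < Z c"
  using measure_above_pos[of 0 c] measure_above_le_Z[of c 0] c by force

text \<open>Jensen under the massless field, with \<open>Y\<close> minus the added mass term. The
  mean of each squared coordinate is at most \<open>4 * exp (K / 2)\<close>, and half of this
  appears in the exponent.\<close>

lemma Z_lower:
  assumes c: "\<And>y. y \<in> I \<Longrightarrow> 0 \<le> c y"
  shows "Z (\<lambda>_. 0) * exp (- 2 * exp (K / 2) * (\<Sum>x\<in>I. c x)) \<le> Z c"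
proof -
  let ?N = "gibbs (\<lambda>_. 0)"
  interpret finite_measure ?N by (rule finite_measure_gibbs) simp
  define Y where "Y = (\<lambda>\<psi>::'i \<Rightarrow> real. - (\<Sum>x\<in>I. c x * (\<psi> x)\<^sup>2) / 2)"
  have [measurable]: "Y \<in> borel_measurable leb" unfolding Y_def by measurable
  have Y0: "Y \<psi> \<le> 0" for \<psi> unfolding Y_def using c by (auto intro!: sum_nonneg)
  have iY: "integrable ?N Y" unfolding Y_def using second_moment(1)[of _ "\<lambda>_. 0"] by auto
  have ieY: "integrable ?N (\<lambda>\<psi>. exp (Y \<psi>))"
    by (rule integrable_const_bound[where B = 1]) (use Y0 in auto)
  have "- 2 * exp (K / 2) * (\<Sum>x\<in>I. c x) * Z (\<lambda>_. 0) \<le> (\<integral>\<psi>. Y \<psi> \<partial>?N)"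
  proof -
    have "(\<integral>\<psi>. Y \<psi> \<partial>?N) = - (\<Sum>x\<in>I. c x * (\<integral>\<psi>. (\<psi> x)\<^sup>2 \<partial>?N)) / 2"
      unfolding Y_def using second_moment(1)[of _ "\<lambda>_. 0"] by (simp add: Bochner_Integration.integral_sum)
    moreover have "(\<Sum>x\<in>I. c x * (\<integral>\<psi>. (\<psi> x)\<^sup>2 \<partial>?N)) \<le> (\<Sum>x\<in>I. c x * (4 * exp (K / 2) * Z (\<lambda>_. 0)))"
      unfolding Z_def using c second_moment(2)[of _ "\<lambda>_. 0"] by (intro sum_mono mult_left_mono) auto
    ultimately show ?thesis by (simp add: sum_distrib_right[symmetric] mult_ac)
  qed
  then have "- 2 * exp (K / 2) * (\<Sum>x\<in>I. c x) \<le> (\<integral>\<psi>. Y \<psi> \<partial>?N) / Z (\<lambda>_. 0)"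
    using Z_pos[of "\<lambda>_. 0"] by (simp add: pos_le_divide_eq)
  then have "Z (\<lambda>_. 0) * exp (- 2 * exp (K / 2) * (\<Sum>x\<in>I. c x)) \<le> Z (\<lambda>_. 0) * exp ((\<integral>\<psi>. Y \<psi> \<partial>?N) / Z (\<lambda>_. 0))"
    using Z_pos[of "\<lambda>_. 0"] by (intro mult_left_mono) auto
  also have "\<dots> \<le> (\<integral>\<psi>. exp (Y \<psi>) \<partial>?N)"
  proof -
    have eq: "(\<integral>\<psi>. indicator (space leb) \<psi> * f \<psi> \<partial>?N) = (\<integral>\<psi>. f \<psi> \<partial>?N)" for f :: "_ \<Rightarrow> real"
      by (rule Bochner_Integration.integral_cong) auto
    have "integrable ?N (\<lambda>\<psi>. indicator (space leb) \<psi> * f \<psi>)" if "integrable ?N f" for f :: "_ \<Rightarrow> real"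
      using that by (subst Bochner_Integration.integrable_cong[OF refl, of _ _ f]) auto
    then show ?thesis
      using measure_exp_mean_le[of ?N "space leb" Y] iY ieY Z_pos[of "\<lambda>_. 0"] finite_measure_axioms
      unfolding eq Z_def by auto
  qed
  also have "(\<integral>\<psi>. exp (Y \<psi>) \<partial>?N) = Z c"
  proof -
    have e: "energy c \<psi> = energy (\<lambda>_. 0) \<psi> - Y \<psi>" for \<psi>
      unfolding energy_def Y_def by (simp add: distrib_right sum.distrib field_simps)
    have "ennreal (\<integral>\<psi>. exp (Y \<psi>) \<partial>?N) = (\<integral>\<^sup>+\<psi>. ennreal (exp (Y \<psi>)) \<partial>?N)"
      using ieY by (intro nn_integral_eq_integral[symmetric]) auto
    also have "\<dots> = (\<integral>\<^sup>+\<psi>. ennreal (exp (- energy c \<psi>)) \<partial>leb)"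
      unfolding gibbs_def by (subst nn_integral_density) (auto simp: ennreal_mult[symmetric] exp_add[symmetric] e)
    also have "\<dots> = emeasure (gibbs c) (space leb)"
      unfolding gibbs_def by (subst emeasure_density) (auto intro!: nn_integral_cong)
    also have "\<dots> = ennreal (Z c)"
      unfolding Z_def using finite_measure.emeasure_eq_measure[OF finite_measure_gibbs[OF c]] by simp
    finally show ?thesis using less_imp_le[OF Z_pos[of c]] c by (subst (asm) ennreal_inj) auto
  qed
  finally show ?thesis .
qed

definition contact :: "real \<Rightarrow> real \<Rightarrow> 'i \<Rightarrow> ('i \<Rightarrow> real) set" where
  "contact a u x = {\<psi> \<in> above u. \<psi> x \<le> - u + a}"

definition contacts :: "real \<Rightarrow> real \<Rightarrow> ('i \<Rightarrow> real) \<Rightarrow> real" where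
  "contacts a u \<psi> = (\<Sum>x\<in>I. indicator {- u..- u + a} (\<psi> x))"

definition Zpin :: "real \<Rightarrow> real \<Rightarrow> ennreal" where
  "Zpin a b = (\<integral>\<^sup>+\<psi>. indicator (above 0) \<psi> * ennreal (exp (b * contacts a 0 \<psi>)) \<partial>gibbs (\<lambda>_. 0))"

lemma sets_contact [measurable]: "x \<in> I \<Longrightarrow> contact a u x \<in> sets leb"
proof -
  assume x: "x \<in> I"
  have "contact a u x = above u \<inter> {\<psi> \<in> space leb. \<psi> x \<le> - u + a}" by (auto simp: contact_def above_def)
  also have "\<dots> \<in> sets leb" using x by measurable
  finally show ?thesis .
qed

lemma measurable_contacts [measurable]: "contacts a u \<in> borel_measurable leb"
  unfolding contacts_def by measurable

lemma contacts_bounds: "0 \<le> contacts a u \<psi>" "contacts a u \<psi> \<le> card I"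
proof -
  show "0 \<le> contacts a u \<psi>" unfolding contacts_def by (intro sum_nonneg) auto
  have "contacts a u \<psi> \<le> (\<Sum>x\<in>I. 1)" unfolding contacts_def by (intro sum_mono) (auto simp: indicator_def)
  then show "contacts a u \<psi> \<le> card I" by simp
qed

text \<open>The extra mass \<open>killing\<close> in the energy absorbs the term linear in \<open>\<psi>\<close> that a constant
  shift creates at the boundary, so that the comparison field is centred exactly.\<close>

lemma energy_shift_const_le:
  assumes \<mu>: "0 \<le> \<mu>" and u: "0 \<le> u"
  shows "energy (\<lambda>_. 0) (shift (\<lambda>_. u) \<psi>) \<le> energy (\<lambda>x. \<mu> + killing x) \<psi> + u\<^sup>2 * (\<Sum>x\<in>I. killing x)"
proof -
  have op: "oper (\<lambda>_. 0) (\<lambda>_. 1) x = killing x" for x by (simp add: oper_def killing_def)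
  have "energy (\<lambda>_. 0) (shift (\<lambda>_. u) \<psi>) = energy (\<lambda>_. 0) \<psi> + u * (\<Sum>x\<in>I. \<psi> x * killing x) + u\<^sup>2 * ((\<Sum>x\<in>I. killing x) / 2)"
    using energy_shift'[of "\<lambda>_. 0" u "\<lambda>_. 1" \<psi>] by (simp add: op energy_oper[of _ "\<lambda>_. 1"])
  also have "u * (\<Sum>x\<in>I. \<psi> x * killing x) \<le> (\<Sum>x\<in>I. (\<mu> + killing x) * (\<psi> x)\<^sup>2) / 2 + u\<^sup>2 * ((\<Sum>x\<in>I. killing x) / 2)"
  proof -
    have "(\<Sum>x\<in>I. 2 * u * (\<psi> x * killing x)) \<le> (\<Sum>x\<in>I. (\<mu> + killing x) * (\<psi> x)\<^sup>2 + u\<^sup>2 * killing x)"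
    proof (rule sum_mono)
      fix x assume x: "x \<in> I"
      have "0 \<le> killing x * (\<psi> x - u)\<^sup>2 + \<mu> * (\<psi> x)\<^sup>2" using killing_bounds(1)[OF x] \<mu> by auto
      then show "2 * u * (\<psi> x * killing x) \<le> (\<mu> + killing x) * (\<psi> x)\<^sup>2 + u\<^sup>2 * killing x"
        by (simp add: power2_eq_square algebra_simps)
    qed
    then show ?thesis by (simp add: sum.distrib sum_distrib_left[symmetric])
  qed
  also have "energy (\<lambda>_. 0) \<psi> + ((\<Sum>x\<in>I. (\<mu> + killing x) * (\<psi> x)\<^sup>2) / 2 + u\<^sup>2 * ((\<Sum>x\<in>I. killing x) / 2)) + u\<^sup>2 * ((\<Sum>x\<in>I. killing x) / 2)
     = energy (\<lambda>x. \<mu> + killing x) \<psi> + u\<^sup>2 * (\<Sum>x\<in>I. killing x)"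
    unfolding energy_def by (simp add: distrib_right sum.distrib field_simps)
  finally show ?thesis by simp
qed

text \<open>Translation by \<open>u\<close> turns positivity into \<open>above u\<close> and
  contacts at level \<open>0\<close> into contacts at level \<open>- u\<close>;
  \<open>energy_shift_const_le\<close> compares the weights.\<close>

lemma Zpin_lower_tilted:
  assumes \<mu>: "0 \<le> \<mu>" and u: "0 \<le> u"
  shows "ennreal (exp (- u\<^sup>2 * (\<Sum>x\<in>I. killing x))) *
     (\<integral>\<^sup>+\<psi>. indicator (above u) \<psi> * ennreal (exp (b * contacts a u \<psi>)) \<partial>gibbs (\<lambda>x. \<mu> + killing x)) \<le> Zpin a b"
proof -
  let ?c = "\<lambda>x. \<mu> + killing x"
  let ?s = "shift (\<lambda>_. u)"
  let ?f = "\<lambda>\<psi>. ennreal (exp (- energy (\<lambda>_. 0) \<psi>)) * (indicator (above 0) \<psi> * ennreal (exp (b * contacts a 0 \<psi>)))"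
  have fm: "?f \<in> borel_measurable leb" by measurable
  have "Zpin a b = (\<integral>\<^sup>+\<psi>. ?f \<psi> \<partial>distr leb leb ?s)"
    unfolding Zpin_def distr_shift gibbs_def by (subst nn_integral_density) auto
  also have "\<dots> = (\<integral>\<^sup>+\<psi>. ?f (?s \<psi>) \<partial>leb)"
    by (rule nn_integral_distr) (use fm in auto)
  also have "\<dots> \<ge> (\<integral>\<^sup>+\<psi>. ennreal (exp (- u\<^sup>2 * (\<Sum>x\<in>I. killing x))) * (ennreal (exp (- energy ?c \<psi>)) *
       (indicator (above u) \<psi> * ennreal (exp (b * contacts a u \<psi>)))) \<partial>leb)"
  proof (rule nn_integral_mono)
    fix \<psi>
    show "ennreal (exp (- u\<^sup>2 * (\<Sum>x\<in>I. killing x))) * (ennreal (exp (- energy ?c \<psi>)) *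
       (indicator (above u) \<psi> * ennreal (exp (b * contacts a u \<psi>)))) \<le> ?f (?s \<psi>)"
    proof (cases "\<psi> \<in> above u")
      case True
      then have "?s \<psi> \<in> above 0"
        by (auto simp: above_def leb_def space_PiM shift_def)
      moreover have "contacts a 0 (?s \<psi>) = contacts a u \<psi>"
        unfolding contacts_def by (intro sum.cong) (auto simp: indicator_def)
      moreover have "exp (- u\<^sup>2 * (\<Sum>x\<in>I. killing x)) * (exp (- energy ?c \<psi>) * exp (b * contacts a u \<psi>))
          \<le> exp (- energy (\<lambda>_. 0) (?s \<psi>)) * exp (b * contacts a u \<psi>)"
        using energy_shift_const_le[OF \<mu> u, of \<psi>] by (simp add: exp_add[symmetric])
      ultimately show ?thesis using True by (simp add: ennreal_mult[symmetric])
    qed simp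
  qed
  also have "(\<integral>\<^sup>+\<psi>. ennreal (exp (- u\<^sup>2 * (\<Sum>x\<in>I. killing x))) * (ennreal (exp (- energy ?c \<psi>)) *
       (indicator (above u) \<psi> * ennreal (exp (b * contacts a u \<psi>)))) \<partial>leb)
    = ennreal (exp (- u\<^sup>2 * (\<Sum>x\<in>I. killing x))) *
     (\<integral>\<^sup>+\<psi>. indicator (above u) \<psi> * ennreal (exp (b * contacts a u \<psi>)) \<partial>gibbs ?c)"
    unfolding gibbs_def by (subst nn_integral_cmult) (auto simp: nn_integral_density)
  finally show ?thesis .
qed

end

section \<open>The deficit of the positivity probability\<close>

text \<open>A discretised Gronwall argument: \<open>w = - ln q\<close> satisfies \<open>- w' \<le> exp (- \<kappa> u) (C B + w) / b\<close>, and \<open>w\<close> vanishes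
  at infinity. The hypotheses hold with \<open>1 - q u / q v\<close> in place of the logarithmic increment, so the
  step \<open>a / (2 J)\<close> has to be small enough, depending on \<open>w(u0)\<close>.\<close>

lemma log_deficit_bound:
  fixes q X :: "real \<Rightarrow> real" and a b \<kappa> C D B u0 :: real
  assumes pos: "0 < a" "0 < b" "0 < \<kappa>" "0 \<le> B" "0 \<le> C" "0 \<le> u0"
    and q: "\<And>u. u0 \<le> u \<Longrightarrow> 0 < q u" "\<And>u. q u \<le> 1" "\<And>u v. u \<le> v \<Longrightarrow> q u \<le> q v"
    and lim: "\<And>e. 0 < e \<Longrightarrow> \<exists>u. 1 - e < q u"
    and slabs: "\<And>u J. u0 \<le> u \<Longrightarrow> 1 \<le> (J::nat) \<Longrightarrow>
        J * exp (2 * \<kappa> * u) * (1 - q u / q (u + a / (2 * real J))) \<le> X (u + a / (2 * real J))"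
    and deficit: "\<And>v. u0 \<le> v \<Longrightarrow> ln (q v) + b * X v \<le> (v\<^sup>2 + D) * B"
    and C: "\<And>u v. u0 \<le> u \<Longrightarrow> u \<le> v \<Longrightarrow> v \<le> u + a / 2 \<Longrightarrow> v\<^sup>2 + D \<le> C * exp (\<kappa> * u)"
    and u0: "8 * exp (- \<kappa> * u0) / (\<kappa> * a * b) \<le> 1 / 2"
  shows "- ln (q u0) \<le> C * B"
proof -
  define w0 where "w0 = - ln (q u0)"
  have w0: "0 \<le> w0" using q(1)[of u0] q(2)[of u0] by (simp add: w0_def ln_le_zero_iff)
  \<comment> \<open>From \<open>u0\<close> on, \<open>- ln q\<close> is at most \<open>w0\<close>,
    so the deficit hypothesis bounds \<open>X (u + s)\<close> by \<open>R\<close> in units of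
    \<open>exp (\<kappa> * u)\<close>.\<close>
  define R where "R = (C * B + w0) / b"
  have R: "0 \<le> R" unfolding R_def using pos w0 by simp
  \<comment> \<open>The first condition keeps \<open>q u / q (u + s)\<close> at least one half; the
    second gives \<open>\<kappa> * s \<le> 1\<close>.\<close>
  obtain J :: nat where J: "2 * R \<le> J" "\<kappa> * a \<le> J" "1 \<le> J"
  proof -
    have "2 * R \<le> nat \<lceil>2 * R\<rceil> + nat \<lceil>\<kappa> * a\<rceil> + 1" "\<kappa> * a \<le> nat \<lceil>2 * R\<rceil> + nat \<lceil>\<kappa> * a\<rceil> + 1"
      by linarith+
    then show ?thesis using that[of "nat \<lceil>2 * R\<rceil> + nat \<lceil>\<kappa> * a\<rceil> + 1"] by auto
  qed
  define s where "s = a / (2 * real J)"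
  have s: "0 < s" "s \<le> a / 2" "\<kappa> * s \<le> 1"
    using pos J by (auto simp: s_def field_simps)
  \<comment> \<open>Chosen so that each increment of \<open>ln q\<close> is at most the drop of
    \<open>L * exp (- \<kappa> * u)\<close> over the same step; the sum then telescopes.\<close>
  define L where "L = 8 * R / (\<kappa> * a)"
  have L: "0 \<le> L" using R pos by (simp add: L_def)
  have step: "ln (q (u + s)) - ln (q u) \<le> L * (exp (- \<kappa> * u) - exp (- \<kappa> * (u + s)))" if u: "u0 \<le> u" for u
  proof -
    let ?v = "u + s"
    let ?r = "q u / q ?v"
    have qp: "0 < q u" "0 < q ?v" "0 < q u0" using u s q(1) by auto
    have e1: "1 \<le> exp (\<kappa> * u)" using u pos by simp
    have "- w0 \<le> ln (q ?v)" unfolding w0_def using qp q(3)[of u0 ?v] u s by simp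
    then have "b * X ?v \<le> (?v\<^sup>2 + D) * B + w0" using deficit[of ?v] u s by simp
    also have "\<dots> \<le> C * exp (\<kappa> * u) * B + exp (\<kappa> * u) * w0"
      using C[of u ?v] u s pos e1 w0 mult_right_mono[of 1 "exp (\<kappa> * u)" w0] by (intro add_mono mult_right_mono) auto
    also have "\<dots> = b * (exp (\<kappa> * u) * R)" using pos by (simp add: R_def field_simps)
    finally have X: "X ?v \<le> exp (\<kappa> * u) * R" using pos by simp
    have "real J * exp (2 * \<kappa> * u) * (1 - ?r) \<le> X ?v" using slabs[OF u J(3)] by (simp add: s_def)
    moreover have "real J * exp (2 * \<kappa> * u) * (1 - ?r) = exp (\<kappa> * u) * (J * exp (\<kappa> * u) * (1 - ?r))"
      using exp_add[of "\<kappa> * u" "\<kappa> * u"] by (simp add: mult.assoc)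
    ultimately have "exp (\<kappa> * u) * (J * exp (\<kappa> * u) * (1 - ?r)) \<le> exp (\<kappa> * u) * R" using X by linarith
    then have "real J * exp (\<kappa> * u) * (1 - ?r) \<le> R" by simp
    then have r: "1 - ?r \<le> R * exp (- \<kappa> * u) / J" using J by (simp add: field_simps exp_minus)
    also have "\<dots> \<le> R * 1 / J" using R u pos by (intro divide_right_mono mult_left_mono) auto
    also have "\<dots> \<le> 1 / 2" using J by (simp add: field_simps)
    finally have r2: "1 / 2 \<le> ?r" by simp
    have "ln (q ?v) - ln (q u) = ln (q ?v / q u)" using qp by (simp add: ln_div)
    also have "\<dots> \<le> q ?v / q u - 1" using qp by (intro ln_le_minus_one) auto
    also have "\<dots> = (1 - ?r) / ?r" using qp by (simp add: field_simps)
    also have "\<dots> \<le> (1 - ?r) / (1 / 2)"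
      using r2 q(3)[of u ?v] qp s by (intro divide_left_mono) (auto simp: field_simps)
    also have "\<dots> = 2 * (1 - ?r)" by simp
    also have "\<dots> \<le> 2 * (R * exp (- \<kappa> * u) / J)" using r by (intro mult_left_mono) auto
    also have "\<dots> = L * exp (- \<kappa> * u) * (\<kappa> * s / 2)"
      using pos J by (simp add: L_def s_def field_simps)
    also have "\<dots> \<le> L * exp (- \<kappa> * u) * (1 - exp (- \<kappa> * s))"
    proof (rule mult_left_mono)
      have q0: "0 < 1 + \<kappa> * s" using pos s by (simp add: add_pos_pos)
      have "exp (- \<kappa> * s) = 1 / exp (\<kappa> * s)" by (simp add: exp_minus field_simps)
      also have "\<dots> \<le> 1 / (1 + \<kappa> * s)" using q0 by (intro divide_left_mono) (auto intro: exp_ge_add_one_self)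
      also have "\<dots> \<le> 1 - \<kappa> * s / 2"
      proof -
        have p: "0 < \<kappa> * s" using pos s by simp
        then have "0 \<le> (\<kappa> * s) * (1 - \<kappa> * s)" using s by (metis diff_ge_0_iff_ge less_imp_le mult_nonneg_nonneg)
        then show ?thesis using p by (simp add: field_simps)
      qed
      finally show "\<kappa> * s / 2 \<le> 1 - exp (- \<kappa> * s)" by simp
    qed (use L in auto)
    also have "\<dots> = L * (exp (- \<kappa> * u) - exp (- \<kappa> * (u + s)))"
      by (simp add: algebra_simps exp_add[symmetric] exp_diff exp_minus divide_inverse)
    finally show ?thesis .
  qed
  have tel: "ln (q (u0 + k * s)) + w0 \<le> L * (exp (- \<kappa> * u0) - exp (- \<kappa> * (u0 + k * s)))" for k :: nat
  proof (induction k)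
    case 0 show ?case by (simp add: w0_def)
  next
    case (Suc k)
    have e: "u0 + Suc k * s = (u0 + k * s) + s" by (simp add: algebra_simps)
    have "u0 \<le> u0 + k * s" using s by simp
    from step[OF this] Suc show ?case unfolding e by (simp only: right_diff_distrib)
  qed
  define M where "M = L * exp (- \<kappa> * u0)"
  \<comment> \<open>Let the height tend to infinity, where \<open>q\<close> comes arbitrarily close
    to \<open>1\<close>.\<close>
  have "w0 \<le> M"
  proof (rule ccontr)
    assume "\<not> w0 \<le> M"
    then have "0 < 1 - exp (M - w0)" by simp
    then obtain u where "1 - (1 - exp (M - w0)) < q u" using lim by blast
    then have u: "exp (M - w0) < q u" by simp
    obtain k :: nat where "(u - u0) / s \<le> k" using real_arch_simple by blast
    then have k: "u \<le> u0 + k * s" using s by (simp add: field_simps)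
    have "ln (q (u0 + k * s)) + w0 \<le> M"
      using tel[of k] L by (simp add: M_def right_diff_distrib order_trans)
    then have "ln (q (u0 + k * s)) \<le> M - w0" by simp
    moreover have "0 < q (u0 + k * s)" using s by (intro q) auto
    ultimately have "q (u0 + k * s) \<le> exp (M - w0)" by (metis exp_le_cancel_iff exp_ln)
    then show False using u q(3)[OF k] by simp
  qed
  \<comment> \<open>The bound contains \<open>w0\<close> itself, but with a factor at most one half
    by the choice of \<open>u0\<close>, so that it can be absorbed.\<close>
  also have "M = 8 * exp (- \<kappa> * u0) / (\<kappa> * a * b) * (C * B + w0)"
    using pos by (simp add: M_def L_def R_def field_simps)
  also have "\<dots> \<le> 1 / 2 * (C * B + w0)" using u0 pos w0 by (intro mult_right_mono) auto
  finally show ?thesis by (simp add: w0_def)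
qed

section \<open>The comparison field with mass\<close>

context substochastic_kernel
begin

text \<open>Not normalised: probabilities of the comparison field are quotients by
  \<open>mass \<mu> (space leb)\<close>.\<close>

definition mass :: "real \<Rightarrow> ('i \<Rightarrow> real) set \<Rightarrow> real" where
  "mass \<mu> A = measure (gibbs (\<lambda>x. \<mu> + killing x)) A"

lemma coeff_nonneg: "0 \<le> (\<mu>::real) \<Longrightarrow> x \<in> I \<Longrightarrow> 0 \<le> \<mu> + killing x"
  using killing_bounds by simp

lemma finite_measure_mass: "0 \<le> (\<mu>::real) \<Longrightarrow> finite_measure (gibbs (\<lambda>x. \<mu> + killing x))"
  using finite_measure_gibbs[of "\<lambda>x. \<mu> + killing x"] coeff_nonneg by (simp add: mass_def)

lemma mass_above_pos: "0 \<le> \<mu> \<Longrightarrow> 0 \<le> u \<Longrightarrow> 0 < mass \<mu> (above u)"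
  using measure_above_pos[of u "\<lambda>x. \<mu> + killing x"] coeff_nonneg by (simp add: mass_def)

text \<open>Jensen for the number of contacts under the comparison field conditioned on
  \<open>above u\<close>. The cost in the first exponential has two sources: adding the mass, by
  \<open>Z_lower\<close>, and raising the field to height \<open>u\<close>.\<close>

lemma Zpin_lower:
  assumes \<mu>: "0 \<le> (\<mu>::real)" and u: "0 \<le> u" and S: "(\<Sum>x\<in>I. killing x) \<le> \<mu> * card I"
  shows "ennreal (Z (\<lambda>_. 0) * exp (- (4 * exp (K / 2) + u\<^sup>2) * (\<mu> * card I)) *
     (mass \<mu> (above u) / mass \<mu> (space leb)) *
     exp (b * ((\<Sum>x\<in>I. mass \<mu> (contact a u x)) / mass \<mu> (above u)))) \<le> Zpin a b"
proof -
  let ?c = "\<lambda>x. \<mu> + killing x" and ?A = "above u" and ?S = "\<Sum>x\<in>I. killing x"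
  interpret finite_measure "gibbs ?c" using \<mu> by (rule finite_measure_mass)
  have Zc: "0 < Z ?c" using Z_pos[of ?c] coeff_nonneg[OF \<mu>] by simp
  have mA: "0 < measure (gibbs ?c) ?A" using mass_above_pos[OF \<mu> u] by (simp add: mass_def)
  let ?X = "(\<Sum>x\<in>I. mass \<mu> (contact a u x)) / mass \<mu> ?A"
  have ind: "indicator ?A \<psi> * contacts a u \<psi> = (\<Sum>x\<in>I. indicator (contact a u x) \<psi>)" for \<psi>
    unfolding contacts_def sum_distrib_left
    by (intro sum.cong refl) (auto simp: indicator_def contact_def above_def)
  have meanY: "(\<integral>\<psi>. indicator ?A \<psi> * (b * contacts a u \<psi>) \<partial>gibbs ?c) = b * (\<Sum>x\<in>I. mass \<mu> (contact a u x))"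
  proof -
    have "(\<integral>\<psi>. indicator ?A \<psi> * (b * contacts a u \<psi>) \<partial>gibbs ?c)
       = (\<integral>\<psi>. b * (\<Sum>x\<in>I. indicator (contact a u x) \<psi>) \<partial>gibbs ?c)"
      by (intro Bochner_Integration.integral_cong refl) (simp add: ind[symmetric])
    also have "\<dots> = b * (\<Sum>x\<in>I. \<integral>\<psi>. indicator (contact a u x) \<psi> \<partial>gibbs ?c)"
      by (subst integral_mult_right_zero, subst Bochner_Integration.integral_sum) (auto simp: emeasure_eq_measure)
    also have "\<dots> = b * (\<Sum>x\<in>I. mass \<mu> (contact a u x))"
      unfolding mass_def
      using sets.sets_into_space[OF sets_contact] by (intro arg_cong[where f = "(*) b"] sum.cong refl) (auto simp: Int_absorb2)
    finally show ?thesis .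
  qed
  have bd: "\<bar>b * contacts a u \<psi>\<bar> \<le> \<bar>b\<bar> * card I" for \<psi>
    unfolding abs_mult using contacts_bounds[of a u \<psi>] by (intro mult_left_mono) auto
  have i1: "integrable (gibbs ?c) (\<lambda>\<psi>. indicator ?A \<psi> * (b * contacts a u \<psi>))"
    by (rule integrable_const_bound[where B = "\<bar>b\<bar> * card I"]) (use bd in \<open>auto simp: indicator_def\<close>)
  have i2: "integrable (gibbs ?c) (\<lambda>\<psi>. indicator ?A \<psi> * exp (b * contacts a u \<psi>))"
    by (rule integrable_const_bound[where B = "exp (\<bar>b\<bar> * card I)"])
      (use bd in \<open>auto simp: indicator_def intro: abs_le_D1\<close>)
  have "measure (gibbs ?c) ?A * exp (b * ?X) \<le> (\<integral>\<psi>. indicator ?A \<psi> * exp (b * contacts a u \<psi>) \<partial>gibbs ?c)"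
    using measure_exp_mean_le[OF finite_measure_axioms _ mA i1 i2] by (simp add: meanY mass_def)
  then have "ennreal (measure (gibbs ?c) ?A * exp (b * ?X)) \<le> ennreal (\<integral>\<psi>. indicator ?A \<psi> * exp (b * contacts a u \<psi>) \<partial>gibbs ?c)"
    by (rule ennreal_leI)
  also have "\<dots> = (\<integral>\<^sup>+\<psi>. ennreal (indicator ?A \<psi> * exp (b * contacts a u \<psi>)) \<partial>gibbs ?c)"
    using i2 by (intro nn_integral_eq_integral[symmetric]) auto
  also have "\<dots> = (\<integral>\<^sup>+\<psi>. indicator ?A \<psi> * ennreal (exp (b * contacts a u \<psi>)) \<partial>gibbs ?c)"
    by (intro nn_integral_cong) (auto simp: indicator_def)
  finally have "ennreal (exp (- u\<^sup>2 * ?S)) * ennreal (measure (gibbs ?c) ?A * exp (b * ?X)) \<le> Zpin a b"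
    using Zpin_lower_tilted[OF \<mu> u, of b a] by (meson mult_left_mono order_trans zero_le)
  then have 1: "ennreal (exp (- u\<^sup>2 * ?S) * (measure (gibbs ?c) ?A * exp (b * ?X))) \<le> Zpin a b"
    by (simp add: ennreal_mult')
  \<comment> \<open>The coefficients \<open>\<mu> + killing x\<close> sum to at most
    \<open>2 * \<mu> * card I\<close>, which doubles the constant of \<open>Z_lower\<close>.\<close>
  have "Z (\<lambda>_. 0) * exp (- (4 * exp (K / 2)) * (\<mu> * card I)) \<le> Z (\<lambda>_. 0) * exp (- 2 * exp (K / 2) * (\<Sum>x\<in>I. ?c x))"
    using Z_pos[of "\<lambda>_. 0"] S by (intro mult_left_mono) (auto simp: sum.distrib)
  also have "\<dots> \<le> Z ?c" using coeff_nonneg[OF \<mu>] by (rule Z_lower)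
  finally have 2: "Z (\<lambda>_. 0) * exp (- (4 * exp (K / 2)) * (\<mu> * card I)) \<le> Z ?c" .
  have 3: "exp (- (u\<^sup>2) * (\<mu> * card I)) \<le> exp (- u\<^sup>2 * ?S)"
    using mult_left_mono[OF S, of "u\<^sup>2"] by simp
  have "Z (\<lambda>_. 0) * exp (- (4 * exp (K / 2) + u\<^sup>2) * (\<mu> * card I)) =
      (Z (\<lambda>_. 0) * exp (- (4 * exp (K / 2)) * (\<mu> * card I))) * exp (- (u\<^sup>2) * (\<mu> * card I))"
    by (simp add: mult.assoc exp_add[symmetric] algebra_simps)
  also have "\<dots> \<le> Z ?c * exp (- u\<^sup>2 * ?S)"
    using 2 3 Zc by (intro mult_mono) auto
  finally have "Z (\<lambda>_. 0) * exp (- (4 * exp (K / 2) + u\<^sup>2) * (\<mu> * card I)) * (mass \<mu> ?A / mass \<mu> (space leb)) * exp (b * ?X)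
     \<le> Z ?c * exp (- u\<^sup>2 * ?S) * (mass \<mu> ?A / mass \<mu> (space leb)) * exp (b * ?X)"
    by (intro mult_right_mono) (auto simp: mass_def)
  also have "\<dots> = exp (- u\<^sup>2 * ?S) * (measure (gibbs ?c) ?A * exp (b * ?X))"
    using Zc unfolding mass_def Z_def by (simp add: field_simps)
  finally show ?thesis using 1 by (meson ennreal_leI order_trans)
qed

lemma mass_shift:
  assumes "0 \<le> \<mu>" "A \<in> sets leb" "B \<in> sets leb"
    and "\<And>\<psi>. \<psi> \<in> A \<Longrightarrow> shift v \<psi> \<in> B"
    and "\<And>\<psi>. \<psi> \<in> A \<Longrightarrow> energy (\<lambda>x. \<mu> + killing x) (shift v \<psi>) \<le> energy (\<lambda>x. \<mu> + killing x) \<psi> - \<gamma>"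
  shows "exp \<gamma> * mass \<mu> A \<le> mass \<mu> B"
  unfolding mass_def
  using assms coeff_nonneg[OF assms(1)] by (intro measure_gibbs_shift[where v = v]) auto

lemma above_mono: "u \<le> v \<Longrightarrow> above u \<subseteq> above v"
  unfolding above_def by force

lemma shift_in_space [simp]: "shift v \<psi> \<in> space leb"
  by (simp add: leb_def space_PiM shift_def)

lemma mass_mono: "0 \<le> \<mu> \<Longrightarrow> A \<subseteq> B \<Longrightarrow> B \<in> sets leb \<Longrightarrow> mass \<mu> A \<le> mass \<mu> B"
  unfolding mass_def using finite_measure.finite_measure_mono[OF finite_measure_mass] by simp

lemma mass_disjoint_UN:
  assumes "0 \<le> \<mu>" "finite S" "\<And>k. k \<in> S \<Longrightarrow> B k \<in> sets leb" "disjoint_family_on B S"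
  shows "(\<Sum>k\<in>S. mass \<mu> (B k)) = mass \<mu> (\<Union>k\<in>S. B k)"
  unfolding mass_def
  using finite_measure.finite_measure_finite_Union[OF finite_measure_mass, of \<mu> S B] assms
  by (simp add: image_subset_iff)

lemma mass_UN_le:
  assumes "0 \<le> \<mu>" "finite S" "\<And>k. k \<in> S \<Longrightarrow> B k \<in> sets leb"
  shows "mass \<mu> (\<Union>k\<in>S. B k) \<le> (\<Sum>k\<in>S. mass \<mu> (B k))"
  unfolding mass_def
  using finite_measure.finite_measure_subadditive_finite[OF finite_measure_mass, of \<mu> S B] assms
  by (simp add: image_subset_iff)

section \<open>Lifting configurations into the contact window\<close>

definition near_floor :: "real \<Rightarrow> 'i \<Rightarrow> real \<Rightarrow> real \<Rightarrow> ('i \<Rightarrow> real) set" where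
  "near_floor u x lo hi = {\<psi> \<in> above u. lo \<le> \<psi> x \<and> \<psi> x < hi}"

lemma sets_near_floor [measurable]: "x \<in> I \<Longrightarrow> near_floor u x lo hi \<in> sets leb"
proof -
  assume x: "x \<in> I"
  have "near_floor u x lo hi = above u \<inter> {\<psi> \<in> space leb. lo \<le> \<psi> x \<and> \<psi> x < hi}"
    by (auto simp: near_floor_def above_def)
  also have "\<dots> \<in> sets leb" using x by measurable
  finally show ?thesis .
qed

end

text \<open>Both indices are the integer part of the same quotient.\<close>

lemma disjoint_slabs:
  assumes "0 < (s::real)" "(y - c) / s < real j + 1" "real j \<le> (y - c) / s"
    "(y - c) / s < real k + 1" "real k \<le> (y - c) / s"
  shows "j = k"
  using assms by linarith

context substochastic_kernel
begin

text \<open>Lifting by \<open>(t / g x) g\<close>, with \<open>g\<close> the Green function of \<open>x\<close>, raises \<open>\<psi> x\<close> by \<open>t\<close>, preserves the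
  lower bounds since \<open>g \<ge> 0\<close>, and changes the energy by a function of \<open>\<psi> x\<close> only. The \<open>J\<close>
  translates of the slab of width \<open>a / (2 J)\<close> tile the upper half of the contact window.\<close>

lemma contact_slabs:
  fixes J :: nat
  assumes \<mu>: "0 \<le> \<mu>" and a: "0 < a" "a \<le> u" and J: "1 \<le> J"
  defines "v \<equiv> u + a / (2 * real J)"
  shows "real J * exp (a * u / (4 * K)) * (mass \<mu> (above v) - mass \<mu> (above u)) \<le> (\<Sum>x\<in>I. mass \<mu> (contact a v x))"
proof -
  let ?c = "\<lambda>x. \<mu> + killing x"
  define s where "s = a / (2 * real J)"
  have s: "0 < s" "J * s = a / 2" using a J by (auto simp: s_def)
  have v: "v = u + s" by (simp add: v_def s_def)
  \<comment> \<open>Fields that violate \<open>above u\<close> at \<open>x\<close>, while at every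
    site any violation has depth at most \<open>s\<close>.\<close>
  define D where "D = (\<lambda>x. near_floor v x (- v) (- u))"
  have site: "real J * exp (a * u / (4 * K)) * mass \<mu> (D x) \<le> mass \<mu> (contact a v x)" if x: "x \<in> I" for x
  proof -
    obtain g where g0: "\<forall>y\<in>I. 0 \<le> g y" and g: "\<forall>y\<in>I. oper ?c g y = (if y = x then 1 else 0)"
      and gx: "0 < g x" "g x \<le> K"
      using green_exists[where c = ?c, OF coeff_nonneg[OF \<mu>] x] by auto
    define B where "B = (\<lambda>j::nat. near_floor v x (- v + a / 2 + j * s) (- v + a / 2 + j * s + s))"
    have step: "exp (a * u / (4 * K)) * mass \<mu> (D x) \<le> mass \<mu> (B j)" if j: "j < J" for j
    proof -
      \<comment> \<open>Lifts between \<open>a / 2\<close> and \<open>a\<close>: large enough for a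
        gain proportional to \<open>a\<close>, small enough to stay within the window.\<close>
      define t where "t = a / 2 + j * s"
      have "real j * s + s \<le> J * s"
        using j s by (metis Suc_leI add.commute distrib_right mult.left_neutral mult_right_mono of_nat_Suc of_nat_le_iff less_imp_le)
      then have t: "a / 2 \<le> t" "t + s \<le> a" using s by (auto simp: t_def)
      show ?thesis
      proof (rule mass_shift[OF \<mu>, where v = "\<lambda>y. (t / g x) * g y"])
        fix \<psi> assume \<psi>: "\<psi> \<in> D x"
        have p: "\<psi> x < - u" "- v \<le> \<psi> x" "\<psi> \<in> above v" using \<psi> by (auto simp: D_def near_floor_def)
        have "shift (\<lambda>y. (t / g x) * g y) \<psi> \<in> above v"
        proof -
          have "- v \<le> \<psi> y + t / g x * g y" if "y \<in> I" for y
          proof -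
            have "0 \<le> t / g x * g y" using t a gx g0 that by auto
            then show ?thesis using p(3) that by (force simp: above_def)
          qed
          then show ?thesis by (auto simp: above_def)
        qed
        then show "shift (\<lambda>y. (t / g x) * g y) \<psi> \<in> B j"
          using p x gx t by (auto simp: B_def near_floor_def t_def v)
        have Eg: "energy ?c g = g x / 2"
          unfolding energy_oper sum_mult_oper_green[OF g x] by simp
        have "energy ?c (shift (\<lambda>y. (t / g x) * g y) \<psi>) = energy ?c \<psi> + (t / g x) * (\<psi> x + t / 2)"
          unfolding energy_shift' sum_mult_oper_green[OF g x] Eg using gx by (simp add: field_simps power2_eq_square)
        \<comment> \<open>Since \<open>\<psi> x < - u\<close> and \<open>t \<le> a \<le> u\<close>,
          the second factor is at most \<open>- (u / 2)\<close>.\<close>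
        moreover have "(t / g x) * (\<psi> x + t / 2) \<le> (t / g x) * (- (u / 2))"
          using p t a gx s by (intro mult_left_mono) auto
        moreover have "a / 2 / K * (u / 2) \<le> t / g x * (u / 2)"
          using t a gx by (intro mult_right_mono frac_le) auto
        ultimately show "energy ?c (shift (\<lambda>y. (t / g x) * g y) \<psi>) \<le> energy ?c \<psi> - a * u / (4 * K)"
          by simp
      qed (use x in \<open>auto simp: D_def B_def\<close>)
    qed
    have "real J * exp (a * u / (4 * K)) * mass \<mu> (D x) = (\<Sum>j<J. exp (a * u / (4 * K)) * mass \<mu> (D x))" by simp
    also have "\<dots> \<le> (\<Sum>j<J. mass \<mu> (B j))" using step by (intro sum_mono) auto
    also have "\<dots> = mass \<mu> (\<Union>j<J. B j)"
    proof (rule mass_disjoint_UN[OF \<mu>])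
      show "disjoint_family_on B {..<J}"
        unfolding disjoint_family_on_def
      proof (intro ballI impI)
        fix j k :: nat assume jk: "j \<noteq> k"
        have False if "\<psi> \<in> B j" "\<psi> \<in> B k" for \<psi>
        proof -
          have "j = k"
            by (rule disjoint_slabs[of s "\<psi> x" "- v + a / 2"])
              (use that s in \<open>auto simp: B_def near_floor_def field_simps\<close>)
          then show False using jk by simp
        qed
        then show "B j \<inter> B k = {}" by auto
      qed
    qed (use x in \<open>auto simp: B_def\<close>)
    also have "\<dots> \<le> mass \<mu> (contact a v x)"
    proof (rule mass_mono[OF \<mu>])
      show "(\<Union>j<J. B j) \<subseteq> contact a v x"
      proof
        fix \<psi> assume "\<psi> \<in> (\<Union>j<J. B j)"
        then obtain j where j: "j < J" "\<psi> \<in> B j" by auto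
        have "real j * s + s \<le> J * s"
          using j s by (metis Suc_leI add.commute distrib_right mult.left_neutral mult_right_mono of_nat_Suc of_nat_le_iff less_imp_le)
        then show "\<psi> \<in> contact a v x" using j s by (auto simp: B_def near_floor_def contact_def)
      qed
    qed (use x in auto)
    finally show ?thesis .
  qed
  \<comment> \<open>A union bound over the sites where \<open>above u\<close> can fail.\<close>
  have "above v \<subseteq> above u \<union> (\<Union>x\<in>I. D x)"
    by (auto simp: D_def near_floor_def above_def not_le)
  then have "mass \<mu> (above v) \<le> mass \<mu> (above u \<union> (\<Union>x\<in>I. D x))"
    using fin by (intro mass_mono \<mu> sets.Un sets.finite_UN) (auto simp: D_def)
  also have "\<dots> \<le> mass \<mu> (above u) + mass \<mu> (\<Union>x\<in>I. D x)"
    unfolding mass_def using fin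
    by (intro measure_Un_le sets.finite_UN) (auto simp: D_def)
  also have "mass \<mu> (\<Union>x\<in>I. D x) \<le> (\<Sum>x\<in>I. mass \<mu> (D x))"
    using fin by (intro mass_UN_le \<mu>) (auto simp: D_def)
  finally have "mass \<mu> (above v) - mass \<mu> (above u) \<le> (\<Sum>x\<in>I. mass \<mu> (D x))" by simp
  then have "real J * exp (a * u / (4 * K)) * (mass \<mu> (above v) - mass \<mu> (above u))
      \<le> J * exp (a * u / (4 * K)) * (\<Sum>x\<in>I. mass \<mu> (D x))" by (intro mult_left_mono) auto
  also have "\<dots> \<le> (\<Sum>x\<in>I. mass \<mu> (contact a v x))"
    unfolding sum_distrib_left using site by (intro sum_mono) auto
  finally show ?thesis .
qed

text \<open>As \<open>I\<close> is finite, the sets \<open>above k\<close> exhaust the space;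
  continuity from below applies.\<close>

lemma mass_above_limit:
  assumes \<mu>: "0 \<le> \<mu>" and e: "0 < e"
  shows "\<exists>u. 1 - e < mass \<mu> (above u) / mass \<mu> (space leb)"
proof -
  interpret finite_measure "gibbs (\<lambda>x. \<mu> + killing x)" using \<mu> by (rule finite_measure_mass)
  have pos: "0 < mass \<mu> (space leb)"
    using Z_pos[of "\<lambda>x. \<mu> + killing x"] coeff_nonneg[OF \<mu>] by (simp add: Z_def mass_def)
  have U: "(\<Union>k. above (real k)) = space leb"
  proof -
    have "\<exists>k. \<psi> \<in> above (real k)" if "\<psi> \<in> space leb" for \<psi>
    proof -
      obtain k :: nat where k: "(\<Sum>x\<in>I. \<bar>\<psi> x\<bar>) \<le> k" using real_arch_simple by blast
      have "- real k \<le> \<psi> x" if "x \<in> I" for x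
        using member_le_sum[of x I "\<lambda>x. \<bar>\<psi> x\<bar>"] that fin k by auto
      then show ?thesis using that by (auto simp: above_def)
    qed
    then show ?thesis by (auto simp: above_def)
  qed
  have "incseq (\<lambda>k. above (real k))" by (auto simp: incseq_def intro!: above_mono)
  then have "(\<lambda>k. mass \<mu> (above (real k))) \<longlonglongrightarrow> mass \<mu> (space leb)"
    unfolding mass_def using finite_Lim_measure_incseq[of "\<lambda>k. above (real k)"] U
    by (simp add: image_subset_iff)
  then have "(\<lambda>k. mass \<mu> (above (real k)) / mass \<mu> (space leb)) \<longlonglongrightarrow> 1"
    using pos tendsto_divide[OF _ tendsto_const, of _ "mass \<mu> (space leb)" sequentially "mass \<mu> (space leb)"] by fastforce
  then have "eventually (\<lambda>k. 1 - e < mass \<mu> (above (real k)) / mass \<mu> (space leb)) sequentially"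
    by (rule order_tendstoD) (use e in simp)
  then show ?thesis by (auto simp: eventually_sequentially)
qed

section \<open>Contacts of the conditioned field\<close>

text \<open>Conditioning multiplies an exponential moment by at most the inverse probability, here
  \<open>exp (C * \<mu> * card I)\<close>. For the linear functional \<open>Y\<close> dual to the
  constant field, this cost, the energy and the coefficients are all of order \<open>\<mu>\<close>;
  the factor cancels, and the mean height is bounded independently of \<open>\<mu>\<close>.\<close>

lemma mean_height_bound:
  assumes \<mu>: "0 < (\<mu>::real)" and u: "0 \<le> u" and S: "(\<Sum>x\<in>I. killing x) \<le> \<mu> * card I"
    and q: "- ln (mass \<mu> (above u) / mass \<mu> (space leb)) \<le> C * (\<mu> * card I)"
  shows "(\<integral>\<psi>. indicator (above u) \<psi> * (\<Sum>x\<in>I. \<psi> x + u) \<partial>gibbs (\<lambda>x. \<mu> + killing x))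
     \<le> (3 / 2 + C + 3 * u) * card I * mass \<mu> (above u)"
proof -
  let ?c = "\<lambda>x. \<mu> + killing x" and ?A = "above u" and ?n = "real (card I)"
  have \<mu>0: "0 \<le> \<mu>" using \<mu> by simp
  interpret finite_measure "gibbs ?c" using \<mu>0 by (rule finite_measure_mass)
  have cn: "\<And>y. y \<in> I \<Longrightarrow> 0 \<le> ?c y" using coeff_nonneg[OF \<mu>0] .
  have mA: "0 < mass \<mu> ?A" using mass_above_pos[OF \<mu>0 u] .
  have mS: "0 < mass \<mu> (space leb)"
    using Z_pos[of ?c] cn by (simp add: Z_def mass_def)
  \<comment> \<open>One \<open>killing x\<close> comes from the walk leaving \<open>I\<close>, the
    other from the extra boundary mass.\<close>
  have op: "oper ?c (\<lambda>_. 1) x = \<mu> + 2 * killing x" for x by (simp add: oper_def killing_def)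
  define Y where "Y = (\<lambda>\<psi>::'i \<Rightarrow> real. \<Sum>x\<in>I. \<psi> x * (\<mu> + 2 * killing x))"
  have [measurable]: "Y \<in> borel_measurable leb" unfolding Y_def by measurable
  have E: "energy ?c (\<lambda>_. 1) \<le> 3 / 2 * \<mu> * ?n"
    unfolding energy_oper op using S by (simp add: sum.distrib sum_distrib_left[symmetric])
  have mgf: "has_bochner_integral (gibbs ?c) (\<lambda>\<psi>. exp (Y \<psi>)) (exp (energy ?c (\<lambda>_. 1)) * mass \<mu> (space leb))"
    using gibbs_mgf[of ?c "\<lambda>_. 1", OF cn] unfolding op Y_def mass_def by simp
  have ieY: "integrable (gibbs ?c) (\<lambda>\<psi>. exp (Y \<psi>))" using mgf by (simp add: has_bochner_integral_iff)
  have iY: "integrable (gibbs ?c) Y"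
    unfolding Y_def using integrable_coordinate[of _ ?c] cn by auto
  have ind: "integrable (gibbs ?c) (\<lambda>\<psi>. indicator ?A \<psi> * f \<psi>)" if "integrable (gibbs ?c) f" for f :: "_ \<Rightarrow> real"
    using integrable_mult_indicator[of ?A "gibbs ?c" f] that by simp
  have iF: "integrable (gibbs ?c) (\<lambda>\<psi>. \<Sum>x\<in>I. \<psi> x + u)"
    using integrable_coordinate[of _ ?c] cn by auto
  let ?m = "(\<integral>\<psi>. indicator ?A \<psi> * Y \<psi> \<partial>gibbs ?c)"
  have "mass \<mu> ?A * exp (?m / mass \<mu> ?A) \<le> (\<integral>\<psi>. indicator ?A \<psi> * exp (Y \<psi>) \<partial>gibbs ?c)"
    using measure_exp_mean_le[OF finite_measure_axioms _ _ ind[OF iY] ind[OF ieY]] mA by (simp add: mass_def)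
  also have "\<dots> \<le> (\<integral>\<psi>. exp (Y \<psi>) \<partial>gibbs ?c)"
    by (rule integral_mono[OF ind[OF ieY] ieY]) (auto simp: indicator_def)
  also have "\<dots> = exp (energy ?c (\<lambda>_. 1)) * mass \<mu> (space leb)"
    using mgf by (simp add: has_bochner_integral_iff)
  also have "\<dots> \<le> exp (3 / 2 * \<mu> * ?n) * mass \<mu> (space leb)" using E mS by simp
  finally have "exp (?m / mass \<mu> ?A) \<le> exp (3 / 2 * \<mu> * ?n) * mass \<mu> (space leb) / mass \<mu> ?A"
    using mA by (simp add: pos_le_divide_eq mult.commute)
  then have "?m / mass \<mu> ?A \<le> ln (exp (3 / 2 * \<mu> * ?n) * mass \<mu> (space leb) / mass \<mu> ?A)"
    using mA mS by (subst ln_ge_iff) auto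
  also have "\<dots> = 3 / 2 * \<mu> * ?n - ln (mass \<mu> ?A / mass \<mu> (space leb))"
    using mA mS by (simp add: ln_mult ln_div)
  also have "\<dots> \<le> (3 / 2 + C) * (\<mu> * ?n)" using q by (simp add: algebra_simps)
  finally have m: "?m \<le> (3 / 2 + C) * (\<mu> * ?n) * mass \<mu> ?A" using mA by (simp add: pos_divide_le_eq)
  have "\<mu> * (\<integral>\<psi>. indicator ?A \<psi> * (\<Sum>x\<in>I. \<psi> x + u) \<partial>gibbs ?c)
     = (\<integral>\<psi>. \<mu> * (indicator ?A \<psi> * (\<Sum>x\<in>I. \<psi> x + u)) \<partial>gibbs ?c)" by simp
  also have "\<dots> \<le> (\<integral>\<psi>. indicator ?A \<psi> * Y \<psi> + indicator ?A \<psi> * (3 * u * (\<mu> * ?n)) \<partial>gibbs ?c)"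
  proof (rule integral_mono)
    fix \<psi>
    have "\<mu> * (\<Sum>x\<in>I. \<psi> x + u) \<le> Y \<psi> + 3 * u * (\<mu> * ?n)" if "\<psi> \<in> ?A"
    proof -
      \<comment> \<open>On \<open>above u\<close> every \<open>\<psi> x + u\<close> is nonnegative,
        so adding the boundary coefficients only increases the sum.\<close>
      have "(\<Sum>x\<in>I. \<mu> * (\<psi> x + u)) \<le> (\<Sum>x\<in>I. (\<mu> + 2 * killing x) * (\<psi> x + u))"
        using that killing_bounds by (intro sum_mono mult_right_mono) (auto simp: above_def add.commute neg_le_iff_le minus_le_iff algebra_simps)
      also have "\<dots> = Y \<psi> + u * (\<mu> * ?n + 2 * (\<Sum>x\<in>I. killing x))"
        unfolding Y_def by (simp add: sum.distrib sum_distrib_left sum_distrib_right algebra_simps)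
      also have "\<dots> \<le> Y \<psi> + u * (3 * (\<mu> * ?n))" using S u by (intro add_left_mono mult_left_mono) auto
      finally show ?thesis by (simp add: sum_distrib_left mult_ac)
    qed
    then show "\<mu> * (indicator ?A \<psi> * (\<Sum>x\<in>I. \<psi> x + u)) \<le> indicator ?A \<psi> * Y \<psi> + indicator ?A \<psi> * (3 * u * (\<mu> * ?n))"
      by (auto simp: indicator_def)
  qed (use ind[OF iY] ind[OF iF] in \<open>auto simp: emeasure_eq_measure\<close>)
  also have "\<dots> = ?m + mass \<mu> ?A * (3 * u * (\<mu> * ?n))"
    using ind[OF iY] sets.sets_into_space[OF sets_above[of u]]
    by (subst Bochner_Integration.integral_add) (auto simp: emeasure_eq_measure mass_def Int_absorb2)
  also have "\<dots> \<le> \<mu> * ((3 / 2 + C + 3 * u) * ?n * mass \<mu> ?A)" using m by (simp add: algebra_simps)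
  finally show ?thesis using \<mu> by simp
qed

lemma sum_mult_oper_sym: "(\<Sum>x\<in>I. \<psi> x * oper c r x) = (\<Sum>x\<in>I. r x * oper c \<psi> x)"
proof -
  have *: "(\<Sum>x\<in>I. \<psi> x * oper c r x) = (\<Sum>x\<in>I. (1 + c x) * \<psi> x * r x) - (\<Sum>x\<in>I. \<Sum>y\<in>I. w x y * \<psi> x * r y)" for \<psi> r
    unfolding oper_def right_diff_distrib sum_subtractf sum_distrib_left by (simp add: mult_ac)
  show ?thesis unfolding * double_sum_sym[of r \<psi>] by (simp add: mult_ac)
qed

text \<open>Lowering one site has a linear cost with coefficient at most \<open>3 * u + M\<close>
  and a quadratic cost with coefficient at most \<open>3 / 2\<close>. Both use
  \<open>1 + \<mu> + killing x \<le> 3\<close>.\<close>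

lemma energy_lower_site:
  assumes x: "x \<in> I" and \<mu>: "0 \<le> \<mu>" "\<mu> \<le> 1" and t: "0 \<le> t" "t \<le> M" and u: "0 \<le> u"
    and \<psi>: "\<psi> \<in> above u" and M: "(\<Sum>y\<in>I. w x y * (\<psi> y + u)) \<le> M"
  shows "energy (\<lambda>x. \<mu> + killing x) (shift (\<lambda>y. - t * (if y = x then 1 else 0)) \<psi>)
     \<le> energy (\<lambda>x. \<mu> + killing x) \<psi> + (5 / 2 * M\<^sup>2 + 3 * u * M)"
proof -
  let ?c = "\<lambda>x. \<mu> + killing x" and ?e = "\<lambda>y. if y = x then 1 else 0 :: real"
  have c: "0 \<le> ?c x" "1 + ?c x \<le> 3" using coeff_nonneg \<mu> killing_bounds[OF x] x by auto
  have pick: "(\<Sum>y\<in>I. ?e y * f y) = f x" for f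
  proof -
    have "(\<Sum>y\<in>I. ?e y * f y) = (\<Sum>y\<in>I. if y = x then f y else 0)" by (intro sum.cong) auto
    then show ?thesis using fin x by simp
  qed
  have "energy ?c ?e = oper ?c ?e x / 2" unfolding energy_oper pick ..
  also have "oper ?c ?e x = 1 + ?c x - w x x"
    unfolding oper_def using pick[of "w x"] by (simp add: mult.commute)
  finally have Ee: "energy ?c ?e \<le> 3 / 2" using c nonneg[OF x x] by simp
  have "(\<Sum>y\<in>I. w x y * \<psi> y) \<le> (\<Sum>y\<in>I. w x y * (\<psi> y + u))"
    using u nonneg x by (intro sum_mono mult_left_mono) auto
  then have s: "(\<Sum>y\<in>I. w x y * \<psi> y) \<le> M" using M by simp
  have "- u \<le> \<psi> x" using \<psi> x by (auto simp: above_def)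
  then have "(1 + ?c x) * (- u) \<le> (1 + ?c x) * \<psi> x" using c by (intro mult_left_mono) auto
  moreover have "(1 + ?c x) * u \<le> 3 * u" using c u by (intro mult_right_mono) auto
  ultimately have "- oper ?c \<psi> x \<le> 3 * u + M" unfolding oper_def using s by simp
  then have "t * (- oper ?c \<psi> x) \<le> t * (3 * u + M)" using t by (intro mult_left_mono) auto
  also have "\<dots> \<le> M * (3 * u + M)" using t u by (intro mult_right_mono) auto
  finally have 1: "- t * oper ?c \<psi> x \<le> M * (3 * u + M)" by simp
  have "t\<^sup>2 * energy ?c ?e \<le> M\<^sup>2 * (3 / 2)"
    using t Ee energy_nonneg[of ?c ?e] coeff_nonneg[OF \<mu>(1)] by (intro mult_mono power_mono) auto
  then show ?thesis
    unfolding energy_shift' sum_mult_oper_sym[of \<psi> ?c] pick using 1 by (simp add: power2_eq_square algebra_simps)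
qed

text \<open>By Markov's inequality, on average at least half of the sites are low and have a low
  weighted neighbour sum; this is the event \<open>G x\<close>. Such a site can be lowered into the
  window by a multiple of \<open>a\<close> at bounded cost, and at most \<open>M / a + 1\<close>
  multiples occur.\<close>

lemma contact_lower:
  assumes \<mu>: "0 \<le> \<mu>" "\<mu> \<le> 1" and u: "0 \<le> u" and a: "0 < a" and h: "0 < (h::real)"
    and mean: "(\<integral>\<psi>. indicator (above u) \<psi> * (\<Sum>x\<in>I. \<psi> x + u) \<partial>gibbs (\<lambda>x. \<mu> + killing x))
     \<le> h * card I * mass \<mu> (above u)"
  shows "exp (- (5 / 2 * (4 * h)\<^sup>2 + 3 * u * (4 * h))) / (2 * (4 * h / a + 1)) * card I * mass \<mu> (above u)
     \<le> (\<Sum>x\<in>I. mass \<mu> (contact a u x))"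
proof -
  let ?c = "\<lambda>x. \<mu> + killing x" and ?A = "above u" and ?n = "real (card I)"
  interpret finite_measure "gibbs ?c" using \<mu>(1) by (rule finite_measure_mass)
  \<comment> \<open>Two Markov estimates at level \<open>M\<close>, for the site and for its
    neighbours, each lose at most the fraction \<open>h / M\<close>, a quarter of the sites.\<close>
  define M where "M = 4 * h"
  have M: "0 < M" using h by (simp add: M_def)
  define L where "L = 5 / 2 * M\<^sup>2 + 3 * u * M"
  define G where "G = (\<lambda>x. {\<psi> \<in> ?A. \<psi> x + u \<le> M \<and> (\<Sum>y\<in>I. w x y * (\<psi> y + u)) \<le> M})"
  have G [measurable]: "G x \<in> sets leb" if x: "x \<in> I" for x
  proof -
    have "G x = ?A \<inter> {\<psi> \<in> space leb. \<psi> x + u \<le> M \<and> (\<Sum>y\<in>I. w x y * (\<psi> y + u)) \<le> M}"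
      by (auto simp: G_def above_def)
    also have "\<dots> \<in> sets leb" using x by measurable
    finally show ?thesis .
  qed
  define k0 where "k0 = nat \<lfloor>M / a\<rfloor>"
  have k0: "real k0 \<le> M / a" using M a by (simp add: k0_def)
  have site: "exp (- L) * mass \<mu> (G x) \<le> (M / a + 1) * mass \<mu> (contact a u x)" if x: "x \<in> I" for x
  proof -
    \<comment> \<open>Slabs of width \<open>a\<close>, so that lowering the \<open>k\<close>-th one
      by \<open>k * a\<close> lands in the contact window.\<close>
    define B where "B = (\<lambda>k::nat. G x \<inter> {\<psi> \<in> space leb. k * a \<le> \<psi> x + u \<and> \<psi> x + u < k * a + a})"
    have B: "B k \<in> sets leb" for k unfolding B_def using x by measurable
    have step: "exp (- L) * mass \<mu> (B k) \<le> mass \<mu> (contact a u x)" for k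
    proof (rule mass_shift[OF \<mu>(1) B sets_contact[OF x], where v = "\<lambda>y. - (k * a) * (if y = x then 1 else 0)"])
      fix \<psi> assume "\<psi> \<in> B k"
      then have p: "\<psi> \<in> ?A" "\<psi> x + u \<le> M" "(\<Sum>y\<in>I. w x y * (\<psi> y + u)) \<le> M"
          "k * a \<le> \<psi> x + u" "\<psi> x + u < k * a + a"
        by (auto simp: B_def G_def)
      show "shift (\<lambda>y. - (k * a) * (if y = x then 1 else 0)) \<psi> \<in> contact a u x"
        using p x by (auto simp: contact_def above_def)
      show "energy ?c (shift (\<lambda>y. - (k * a) * (if y = x then 1 else 0)) \<psi>) \<le> energy ?c \<psi> - - L"
        using energy_lower_site[OF x \<mu>, of "k * a" M u \<psi>] p a u by (simp add: L_def)
    qed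
    have "G x \<subseteq> (\<Union>k\<in>{..k0}. B k)"
    proof
      fix \<psi> assume \<psi>: "\<psi> \<in> G x"
      define k where "k = nat \<lfloor>(\<psi> x + u) / a\<rfloor>"
      have p: "0 \<le> \<psi> x + u" "\<psi> x + u \<le> M" "\<psi> \<in> space leb" using \<psi> x by (auto simp: G_def above_def add.commute minus_le_iff le_minus_iff)
      then have kz: "int k = \<lfloor>(\<psi> x + u) / a\<rfloor>" using a by (simp add: k_def)
      have "real k \<le> (\<psi> x + u) / a" "(\<psi> x + u) / a < real k + 1"
        using kz by linarith+
      then have "k * a \<le> \<psi> x + u" "\<psi> x + u < k * a + a" using a by (auto simp: field_simps)
      moreover have "k \<le> k0" unfolding k_def k0_def using p a by (intro nat_mono floor_mono divide_right_mono) auto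
      ultimately show "\<psi> \<in> (\<Union>k\<in>{..k0}. B k)" using \<psi> p by (auto simp: B_def)
    qed
    then have "mass \<mu> (G x) \<le> mass \<mu> (\<Union>k\<in>{..k0}. B k)" using B by (intro mass_mono \<mu>(1) sets.finite_UN) auto
    also have "\<dots> \<le> (\<Sum>k\<in>{..k0}. mass \<mu> (B k))" using B by (intro mass_UN_le \<mu>(1)) auto
    finally have "exp (- L) * mass \<mu> (G x) \<le> (\<Sum>k\<in>{..k0}. exp (- L) * mass \<mu> (B k))"
      by (simp add: sum_distrib_left[symmetric])
    also have "\<dots> \<le> (\<Sum>k\<in>{..k0}. mass \<mu> (contact a u x))" using step by (intro sum_mono)
    also have "\<dots> \<le> (M / a + 1) * mass \<mu> (contact a u x)"
      using k0 by (auto simp: mass_def intro!: mult_right_mono)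
    finally show ?thesis .
  qed
  have iF: "integrable (gibbs ?c) (\<lambda>\<psi>. \<Sum>x\<in>I. \<psi> x + u)"
    using integrable_coordinate[of _ ?c] coeff_nonneg[OF \<mu>(1)] by auto
  have iAF: "integrable (gibbs ?c) (\<lambda>\<psi>. indicator ?A \<psi> * (\<Sum>x\<in>I. \<psi> x + u))"
    using integrable_mult_indicator[of ?A "gibbs ?c", OF _ iF] by simp
  have pw: "indicator ?A \<psi> * ?n - 2 / M * (indicator ?A \<psi> * (\<Sum>x\<in>I. \<psi> x + u)) \<le> (\<Sum>x\<in>I. indicator (G x) \<psi>)" for \<psi>
  proof (cases "\<psi> \<in> ?A")
    case True
    have nn: "0 \<le> \<psi> x + u" if "x \<in> I" for x using True that by (force simp: above_def)
    have pt: "1 - (\<psi> x + u) / M - (\<Sum>y\<in>I. w x y * (\<psi> y + u)) / M \<le> indicator (G x) \<psi>" if x: "x \<in> I" for x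
    proof -
      have s0: "0 \<le> (\<Sum>y\<in>I. w x y * (\<psi> y + u)) / M" using nn nonneg x M
        by (intro divide_nonneg_pos sum_nonneg mult_nonneg_nonneg) auto
      have p0: "0 \<le> (\<psi> x + u) / M" using nn[OF x] M by simp
      show ?thesis
      proof (cases "\<psi> \<in> G x")
        case True
        then show ?thesis using s0 p0 by simp
      next
        case False
        then have "1 \<le> (\<psi> x + u) / M \<or> 1 \<le> (\<Sum>y\<in>I. w x y * (\<psi> y + u)) / M"
          using \<open>\<psi> \<in> ?A\<close> M by (auto simp: G_def)
        then show ?thesis using False s0 p0 by auto
      qed
    qed
    \<comment> \<open>By symmetry and the row sums, averaging over neighbours does not increase the
      total height.\<close>
    have "(\<Sum>x\<in>I. \<Sum>y\<in>I. w x y * (\<psi> y + u)) = (\<Sum>y\<in>I. (\<Sum>x\<in>I. w y x) * (\<psi> y + u))"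
      by (subst sum.swap) (auto simp: sum_distrib_right sym intro!: sum.cong)
    also have "\<dots> \<le> (\<Sum>y\<in>I. 1 * (\<psi> y + u))" using row_sum nn by (intro sum_mono mult_right_mono) auto
    finally have ws: "(\<Sum>x\<in>I. \<Sum>y\<in>I. w x y * (\<psi> y + u)) / M \<le> (\<Sum>y\<in>I. \<psi> y + u) / M"
      using M by (intro divide_right_mono) auto
    have "?n - 2 / M * (\<Sum>x\<in>I. \<psi> x + u) \<le> ?n - (\<Sum>x\<in>I. \<psi> x + u) / M - (\<Sum>x\<in>I. \<Sum>y\<in>I. w x y * (\<psi> y + u)) / M"
      using ws by simp
    also have "\<dots> = (\<Sum>x\<in>I. 1 - (\<psi> x + u) / M - (\<Sum>y\<in>I. w x y * (\<psi> y + u)) / M)"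
      by (simp add: sum_subtractf sum_divide_distrib[symmetric])
    also have "\<dots> \<le> (\<Sum>x\<in>I. indicator (G x) \<psi>)" using pt by (rule sum_mono)
    finally show ?thesis using True by simp
  qed (auto intro!: sum_nonneg)
  have "?n * mass \<mu> ?A / 2 \<le> ?n * mass \<mu> ?A - 2 / M * (\<integral>\<psi>. indicator ?A \<psi> * (\<Sum>x\<in>I. \<psi> x + u) \<partial>gibbs ?c)"
    using mult_left_mono[OF mean, of "2 / M"] M h by (simp add: M_def)
  also have "\<dots> = (\<integral>\<psi>. indicator ?A \<psi> * ?n - 2 / M * (indicator ?A \<psi> * (\<Sum>x\<in>I. \<psi> x + u)) \<partial>gibbs ?c)"
    using iAF sets.sets_into_space[OF sets_above[of u]]
    by (subst Bochner_Integration.integral_diff) (auto simp: emeasure_eq_measure mass_def Int_absorb2)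
  also have "\<dots> \<le> (\<integral>\<psi>. (\<Sum>x\<in>I. indicator (G x) \<psi>) \<partial>gibbs ?c)"
    using iAF pw by (intro integral_mono Bochner_Integration.integrable_diff integrable_mult_right
        Bochner_Integration.integrable_sum) (auto simp: emeasure_eq_measure)
  also have "\<dots> = (\<Sum>x\<in>I. mass \<mu> (G x))"
    using sets.sets_into_space[OF G]
    by (subst Bochner_Integration.integral_sum) (auto simp: emeasure_eq_measure mass_def Int_absorb2 intro!: sum.cong)
  finally have "exp (- L) * (?n * mass \<mu> ?A / 2) \<le> exp (- L) * (\<Sum>x\<in>I. mass \<mu> (G x))" by (rule mult_left_mono) simp
  also have "\<dots> \<le> (M / a + 1) * (\<Sum>x\<in>I. mass \<mu> (contact a u x))"
    unfolding sum_distrib_left using site by (intro sum_mono)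
  finally show ?thesis
    using M a unfolding L_def M_def[symmetric] by (simp add: field_simps)
qed

section \<open>Exponential growth of the pinned partition function\<close>

text \<open>The last condition on \<open>\<mu>\<close> makes \<open>b\<close> times the contact
  density at height \<open>u0\<close> at least the whole deficit
  \<open>(u0\<^sup>2 + D + C) * \<mu>\<close> per site. The strict inequality obtained from failure
  of the claim then yields the contradiction.\<close>

lemma partition_growth:
  fixes a b C D u0 \<mu> \<kappa> h :: real
  assumes ab: "0 < a" "0 < b" and \<kappa>: "\<kappa> = a / (8 * K)" and D: "D = 4 * exp (K / 2) + 1"
    and u0: "a \<le> u0" "8 * exp (- \<kappa> * u0) / (\<kappa> * a * b) \<le> 1 / 2"
    and C: "0 \<le> C" "\<And>u v. u0 \<le> u \<Longrightarrow> u \<le> v \<Longrightarrow> v \<le> u + a / 2 \<Longrightarrow> v\<^sup>2 + D \<le> C * exp (\<kappa> * u)"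
    and h: "h = 3 / 2 + C + 3 * u0"
    and \<mu>: "0 < \<mu>" "\<mu> \<le> 1"
      "(u0\<^sup>2 + D + C) * \<mu> \<le> b * (exp (- (5 / 2 * (4 * h)\<^sup>2 + 3 * u0 * (4 * h))) / (2 * (4 * h / a + 1)))"
    and S: "(\<Sum>x\<in>I. killing x) \<le> \<mu> * card I"
  shows "ennreal (exp (\<mu> * card I) * Z (\<lambda>_. 0)) \<le> Zpin a b"
proof (rule ccontr)
  assume neg: "\<not> ?thesis"
  have \<mu>0: "0 \<le> \<mu>" using \<mu> by simp
  let ?n = "real (card I)"
  define q where "q = (\<lambda>u. mass \<mu> (above u) / mass \<mu> (space leb))"
  define X where "X = (\<lambda>u. (\<Sum>x\<in>I. mass \<mu> (contact a u x)) / mass \<mu> (above u))"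
  have Zp: "0 < Z (\<lambda>_. 0)" by (rule Z_pos) simp
  have mS: "0 < mass \<mu> (space leb)"
    using Z_pos[of "\<lambda>x. \<mu> + killing x"] coeff_nonneg[OF \<mu>0] by (simp add: Z_def mass_def)
  have u00: "0 \<le> u0" using ab u0 by simp
  have \<kappa>0: "0 < \<kappa>" using \<kappa> ab K_pos by simp
  have qpos: "0 < q u" if "0 \<le> u" for u
    using mass_above_pos[OF \<mu>0 that] mS by (simp add: q_def)
  \<comment> \<open>Failure of the claimed growth contributes one more
    \<open>\<mu> * card I\<close>, which is the \<open>+ 1\<close> in \<open>D\<close>.\<close>
  have deficit: "ln (q v) + b * X v < (v\<^sup>2 + D) * (\<mu> * ?n)" if v: "0 \<le> v" for v
  proof -
    have "ennreal (Z (\<lambda>_. 0) * exp (- (4 * exp (K / 2) + v\<^sup>2) * (\<mu> * ?n)) * q v * exp (b * X v))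
        < ennreal (exp (\<mu> * ?n) * Z (\<lambda>_. 0))"
      using Zpin_lower[OF \<mu>0 v S, of b a] neg unfolding q_def X_def by (meson not_le order.strict_trans1)
    then have "Z (\<lambda>_. 0) * exp (- (4 * exp (K / 2) + v\<^sup>2) * (\<mu> * ?n)) * q v * exp (b * X v) < exp (\<mu> * ?n) * Z (\<lambda>_. 0)"
      using Zp by (subst (asm) ennreal_less_iff) (use qpos[OF v] in auto)
    then have "Z (\<lambda>_. 0) * (exp (- (4 * exp (K / 2) + v\<^sup>2) * (\<mu> * ?n)) * q v * exp (b * X v)) < Z (\<lambda>_. 0) * exp (\<mu> * ?n)"
      by (simp add: mult_ac)
    then have "exp (- (4 * exp (K / 2) + v\<^sup>2) * (\<mu> * ?n)) * q v * exp (b * X v) < exp (\<mu> * ?n)"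
      using Zp by simp
    moreover have "exp (- (4 * exp (K / 2) + v\<^sup>2) * (\<mu> * ?n)) * q v * exp (b * X v)
       = exp (- (4 * exp (K / 2) + v\<^sup>2) * (\<mu> * ?n) + ln (q v) + b * X v)"
      using qpos[OF v] by (simp only: exp_add exp_ln)
    ultimately have "- (4 * exp (K / 2) + v\<^sup>2) * (\<mu> * ?n) + ln (q v) + b * X v < \<mu> * ?n" by simp
    then show ?thesis unfolding D by (simp add: algebra_simps)
  qed
  have mono: "mass \<mu> (above u) \<le> mass \<mu> (above v)" if "u \<le> v" for u v
    using above_mono[OF that] by (intro mass_mono \<mu>0) auto
  have bound: "- ln (q u0) \<le> C * (\<mu> * ?n)"
  proof (rule log_deficit_bound[where a = a and b = b and \<kappa> = \<kappa> and D = D and X = X and q = q and ?u0.0 = u0])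
    show "0 < q u" if "u0 \<le> u" for u using qpos that u00 by simp
    show "q u \<le> 1" for u
      unfolding q_def using mS mass_mono[OF \<mu>0, of "above u" "space leb"] by (auto simp: above_def)
    show "q u \<le> q v" if "u \<le> v" for u v unfolding q_def using mono[OF that] mS by (intro divide_right_mono) auto
    show "\<exists>u. 1 - e < q u" if "0 < e" for e unfolding q_def by (rule mass_above_limit[OF \<mu>0 that])
    show "real J * exp (2 * \<kappa> * u) * (1 - q u / q (u + a / (2 * real J))) \<le> X (u + a / (2 * real J))"
      if u: "u0 \<le> u" and J: "1 \<le> J" for u and J :: nat
    proof -
      let ?v = "u + a / (2 * real J)"
      have "0 \<le> ?v" using u u00 ab by simp
      then have p: "0 < mass \<mu> (above ?v)" by (intro mass_above_pos \<mu>0)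
      \<comment> \<open>The exponent \<open>a * u / (4 * K)\<close> of the lifting estimate is
        \<open>2 * \<kappa> * u\<close>. Half of this rate is later spent on the quadratic growth of
        the deficit.\<close>
      have "real J * exp (2 * \<kappa> * u) * (mass \<mu> (above ?v) - mass \<mu> (above u)) \<le> (\<Sum>x\<in>I. mass \<mu> (contact a ?v x))"
        using contact_slabs[OF \<mu>0 ab(1) _ J, of u] u u0 by (simp add: \<kappa>)
      then have "real J * exp (2 * \<kappa> * u) * (mass \<mu> (above ?v) - mass \<mu> (above u)) / mass \<mu> (above ?v) \<le> X ?v"
        unfolding X_def using p by (intro divide_right_mono) auto
      moreover have "1 - q u / q ?v = (mass \<mu> (above ?v) - mass \<mu> (above u)) / mass \<mu> (above ?v)"
        unfolding q_def using p mS by (simp add: field_simps)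
      ultimately show ?thesis by simp
    qed
    show "ln (q v) + b * X v \<le> (v\<^sup>2 + D) * (\<mu> * ?n)" if "u0 \<le> v" for v
      using deficit[of v] that u00 by simp
  qed (use ab \<kappa>0 \<mu>0 C u0 u00 in auto)
  have hp: "0 < h" using h C u00 by simp
  let ?k = "exp (- (5 / 2 * (4 * h)\<^sup>2 + 3 * u0 * (4 * h))) / (2 * (4 * h / a + 1))"
  have "?k * ?n * mass \<mu> (above u0) \<le> (\<Sum>x\<in>I. mass \<mu> (contact a u0 x))"
    using mean_height_bound[OF \<mu>(1) u00 S, of C] bound
    by (intro contact_lower \<mu>0 \<mu> u00 ab hp) (simp add: q_def h)
  then have "?k * ?n \<le> X u0"
    unfolding X_def using mass_above_pos[OF \<mu>0 u00] by (simp add: pos_le_divide_eq)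
  then have "b * (?k * ?n) \<le> b * X u0" using ab by (intro mult_left_mono) auto
  also have "\<dots> < (u0\<^sup>2 + D) * (\<mu> * ?n) + C * (\<mu> * ?n)" using deficit[OF u00] bound by linarith
  also have "\<dots> = (u0\<^sup>2 + D + C) * \<mu> * ?n" by (simp add: algebra_simps)
  also have "\<dots> \<le> b * ?k * ?n" using \<mu>(3) by (rule mult_right_mono) simp
  finally show False by simp
qed

end

text \<open>The rate \<open>\<mu>\<close> depends only on \<open>a\<close>, \<open>b\<close> and
  \<open>K\<close>, so a single value serves all boxes.\<close>

lemma pinned_partition_growth:
  fixes a b K :: real
  assumes ab: "0 < a" "0 < b" and K: "0 < K"
  obtains \<mu> :: real where "0 < \<mu>"
    "\<And>(I :: 'i set) w. substochastic_kernel I w K \<Longrightarrow>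
       (\<Sum>x\<in>I. substochastic_kernel.killing I w x) \<le> \<mu> * card I \<Longrightarrow>
       ennreal (exp (\<mu> * card I) * substochastic_kernel.Z I w (\<lambda>_. 0)) \<le> substochastic_kernel.Zpin I w a b"
proof -
  define \<kappa> where "\<kappa> = a / (8 * K)"
  have \<kappa>: "0 < \<kappa>" using ab K by (simp add: \<kappa>_def)
  define D where "D = 4 * exp (K / 2) + 1"
  have D: "0 \<le> D" unfolding D_def by simp
  \<comment> \<open>Collects the constants of
    \<open>v\<^sup>2 \<le> 2 * u\<^sup>2 + a\<^sup>2 / 2\<close> and of the quadratic lower bound
    for \<open>exp (\<kappa> * u)\<close>.\<close>
  define C where "C = 4 / \<kappa>\<^sup>2 + a\<^sup>2 / 2 + D"
  \<comment> \<open>The first summand allows lifts of size up to \<open>a\<close>. The second gives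
    \<open>\<kappa> * u0 \<ge> 16 / (\<kappa> * a * b)\<close>, hence the same lower bound for
    \<open>exp (\<kappa> * u0)\<close>.\<close>
  define u0 where "u0 = a + 16 / (\<kappa>\<^sup>2 * a * b)"
  have u0: "a \<le> u0" using \<kappa> ab by (simp add: u0_def)
  have C0: "0 \<le> C" using D by (simp add: C_def)
  have C: "v\<^sup>2 + D \<le> C * exp (\<kappa> * u)" if "u0 \<le> u" "u \<le> v" "v \<le> u + a / 2" for u v
  proof -
    have u: "0 \<le> u" using that u0 ab by simp
    have "0 \<le> (u - a / 2)\<^sup>2" by simp
    then have "(u + a / 2)\<^sup>2 \<le> 2 * u\<^sup>2 + a\<^sup>2 / 2" by (simp add: power2_eq_square field_simps)
    moreover have "v\<^sup>2 \<le> (u + a / 2)\<^sup>2" using that u by (intro power_mono) auto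
    moreover have "2 * u\<^sup>2 \<le> 4 / \<kappa>\<^sup>2 * exp (\<kappa> * u)"
    proof -
      have "(\<kappa> * u)\<^sup>2 / 2 \<le> exp (\<kappa> * u)" using exp_lower_Taylor_quadratic[of "\<kappa> * u"] mult_nonneg_nonneg[of \<kappa> u] u \<kappa> by linarith
      then show ?thesis using \<kappa> by (simp add: field_simps power_mult_distrib)
    qed
    moreover have "(a\<^sup>2 / 2 + D) * 1 \<le> (a\<^sup>2 / 2 + D) * exp (\<kappa> * u)"
      using D u \<kappa> by (intro mult_left_mono) auto
    ultimately show ?thesis unfolding C_def by (simp add: distrib_right)
  qed
  have small: "8 * exp (- \<kappa> * u0) / (\<kappa> * a * b) \<le> 1 / 2"
  proof -
    have "16 / (\<kappa> * a * b) = \<kappa> * (16 / (\<kappa>\<^sup>2 * a * b))" using \<kappa> by (simp add: power2_eq_square)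
    also have "\<dots> \<le> \<kappa> * u0" using \<kappa> ab by (intro mult_left_mono) (auto simp: u0_def)
    also have "\<dots> \<le> exp (\<kappa> * u0)" using exp_ge_add_one_self[of "\<kappa> * u0"] by linarith
    finally show ?thesis using \<kappa> ab by (simp add: exp_minus field_simps)
  qed
  define h where "h = 3 / 2 + C + 3 * u0"
  have h: "0 < h" using C0 u0 ab by (simp add: h_def)
  define k where "k = exp (- (5 / 2 * (4 * h)\<^sup>2 + 3 * u0 * (4 * h))) / (2 * (4 * h / a + 1))"
  have k: "0 < k" unfolding k_def using h ab by (intro divide_pos_pos) (auto intro: add_pos_pos)
  have E: "0 < u0\<^sup>2 + D + C" using D C0 u0 ab by (intro add_pos_nonneg) auto
  define \<mu> where "\<mu> = min 1 (b * k / (u0\<^sup>2 + D + C))"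
  have \<mu>: "0 < \<mu>" "\<mu> \<le> 1" using ab k E by (auto simp: \<mu>_def)
  have "(u0\<^sup>2 + D + C) * \<mu> \<le> (u0\<^sup>2 + D + C) * (b * k / (u0\<^sup>2 + D + C))"
    using E by (intro mult_left_mono) (auto simp: \<mu>_def)
  then have \<mu>k: "(u0\<^sup>2 + D + C) * \<mu> \<le> b * k" using E by simp
  show ?thesis
  proof (rule that[OF \<mu>(1)])
    fix I :: "'i set" and w
    assume "substochastic_kernel I w K"
    then interpret substochastic_kernel I w K .
    assume "(\<Sum>x\<in>I. killing x) \<le> \<mu> * card I"
    then show "ennreal (exp (\<mu> * card I) * Z (\<lambda>_. 0)) \<le> Zpin a b"
      using partition_growth[OF ab \<kappa>_def D_def u0 small C0 C h_def \<mu> \<mu>k[unfolded k_def]] by simp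
  qed
qed

section \<open>The lattice\<close>

text \<open>\<open>p\<close>, \<open>q\<close>, \<open>r\<close> are the second-order Taylor
  polynomials of the powers -1/4, -1/2, -1 of \<open>1 + y\<close>, with quadratic coefficients
  raised from 5/32, 3/8 and 1 to absorb remainders. Squaring twice gives \<open>1 / (1 + y) \<le> r
  \<le> q\<^sup>2 \<le> (p\<^sup>2)\<^sup>2\<close>.\<close>

lemma quartic_root_bound:
  fixes y :: real
  assumes y: "\<bar>y\<bar> \<le> 1 / 64"
  shows "(1 + y) powr (- 1 / 4) \<le> 1 - y / 4 + 11 / 64 * y\<^sup>2"
proof -
  define p where "p = 1 - y / 4 + 11 / 64 * y\<^sup>2"
  define q where "q = 1 - y / 2 + 2 / 5 * y\<^sup>2"
  define r where "r = 1 - y + 51 / 50 * y\<^sup>2"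
  have y2: "0 \<le> y\<^sup>2" by simp
  have p: "0 < p" using y y2 unfolding p_def by linarith
  have q: "0 < q" using y y2 unfolding q_def by linarith
  have "p\<^sup>2 - q = y\<^sup>2 * (1 / 160 - 11 / 128 * y + 121 / 4096 * y\<^sup>2)"
    unfolding p_def q_def by (simp add: power2_eq_square field_simps)
  moreover have "0 \<le> 1 / 160 - 11 / 128 * y + 121 / 4096 * y\<^sup>2" using y y2 by linarith
  ultimately have pq: "q \<le> p\<^sup>2" using y2 by (metis diff_ge_0_iff_ge mult_nonneg_nonneg)
  have "q\<^sup>2 - r = y\<^sup>2 * (3 / 100 - 2 / 5 * y + 4 / 25 * y\<^sup>2)"
    unfolding q_def r_def by (simp add: power2_eq_square field_simps)
  moreover have "0 \<le> 3 / 100 - 2 / 5 * y + 4 / 25 * y\<^sup>2" using y y2 by linarith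
  ultimately have qr: "r \<le> q\<^sup>2" using y2 by (metis diff_ge_0_iff_ge mult_nonneg_nonneg)
  have "r * (1 + y) - 1 = y\<^sup>2 * (1 / 50 + 51 / 50 * y)"
    unfolding r_def by (simp add: power2_eq_square field_simps)
  moreover have "0 \<le> 1 / 50 + 51 / 50 * y" using y by linarith
  ultimately have r1: "1 \<le> r * (1 + y)" using y2 by (metis diff_ge_0_iff_ge mult_nonneg_nonneg)
  have y1: "0 < 1 + y" using y by linarith
  have "1 / (1 + y) \<le> r" using r1 y1 by (simp add: pos_divide_le_eq)
  also have "\<dots> \<le> q\<^sup>2" by (rule qr)
  also have "\<dots> \<le> (p\<^sup>2)\<^sup>2" using pq q by (intro power_mono) auto
  also have "(p\<^sup>2)\<^sup>2 = p powr 4" using p by (simp add: powr_numeral)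
  finally have "(1 / (1 + y)) powr (1 / 4) \<le> (p powr 4) powr (1 / 4)"
    using y1 by (intro powr_mono2) auto
  also have "(p powr 4) powr (1 / 4) = p" using p by (subst powr_powr) simp
  also have "(1 / (1 + y)) powr (1 / 4) = (1 + y) powr (- 1 / 4)"
    using y1 by (simp add: powr_divide powr_minus_divide)
  finally show ?thesis by (simp add: p_def)
qed

lemma box_eq: "box d N = {x. set x \<subseteq> {- int (N div 2)..int (N div 2)} \<and> length x = d}"
proof -
  have "\<bar>i\<bar> \<le> m \<longleftrightarrow> i \<in> {- m..m}" for i m :: int by auto
  then show ?thesis unfolding box_def by blast
qed

lemma finite_box: "finite (box d N)"
  unfolding box_eq by (rule finite_lists_length_eq) simp

lemma card_box: "card (box d N) = (2 * (N div 2) + 1) ^ d"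
proof -
  have "card {- int m..int m} = 2 * m + 1" for m by simp
  then show ?thesis unfolding box_eq by (simp only: card_lists_length_eq finite_atLeastAtMost_int)
qed

section \<open>Nearest neighbours in the lattice\<close>

definition lattice_step :: "int list \<Rightarrow> nat \<Rightarrow> int \<Rightarrow> int list" where
  "lattice_step x i s = x[i := x ! i + s]"

lemma adj_sym: "adj x y \<longleftrightarrow> adj y x"
proof -
  have "(\<Sum>i<n. (x ! i - y ! i)\<^sup>2) = (\<Sum>i<n. (y ! i - x ! i)\<^sup>2)" for n
    by (intro sum.cong refl power2_commute)
  from this[of "length x"] show ?thesis unfolding adj_def by (cases "length y = length x") auto
qed

text \<open>A sum of integer squares equals \<open>1\<close> only if one square is \<open>1\<close>
  and the others vanish.\<close>

lemma adj_iff_step: "adj x y \<longleftrightarrow> (\<exists>i<length x. y = lattice_step x i 1 \<or> y = lattice_step x i (- 1))"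
proof
  assume a: "adj x y"
  then have len: "length y = length x" and s: "(\<Sum>i<length x. (x ! i - y ! i)\<^sup>2) = 1"
    by (auto simp: adj_def)
  obtain i where i: "i < length x" "(x ! i - y ! i)\<^sup>2 \<noteq> 0"
    using s by (metis (no_types, lifting) lessThan_iff sum.neutral zero_neq_one)
  have nz: "x ! i - y ! i \<noteq> 0" using i(2) by auto
  have ge: "1 \<le> (x ! i - y ! i)\<^sup>2" using i(2) zero_le_power2[of "x ! i - y ! i"] by linarith
  have split: "(x ! i - y ! i)\<^sup>2 + (\<Sum>j\<in>{..<length x} - {i}. (x ! j - y ! j)\<^sup>2) = 1"
    using s i by (simp add: sum.remove[of "{..<length x}" i])
  have rest: "0 \<le> (\<Sum>j\<in>{..<length x} - {i}. (x ! j - y ! j)\<^sup>2)" by (intro sum_nonneg) auto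
  then have z: "(\<Sum>j\<in>{..<length x} - {i}. (x ! j - y ! j)\<^sup>2) = 0" "(x ! i - y ! i)\<^sup>2 = 1"
    using ge split by auto
  have eq: "y ! j = x ! j" if "j < length x" "j \<noteq> i" for j
    using z(1) that by (subst (asm) sum_nonneg_eq_0_iff) auto
  have "x ! i - y ! i = 1 \<or> x ! i - y ! i = - 1" using z(2) by (simp add: power2_eq_1_iff)
  then have "y = lattice_step x i 1 \<or> y = lattice_step x i (- 1)"
    using len eq i by (auto simp: lattice_step_def list_eq_iff_nth_eq nth_list_update)
  then show "\<exists>i<length x. y = lattice_step x i 1 \<or> y = lattice_step x i (- 1)" using i by blast
next
  assume "\<exists>i<length x. y = lattice_step x i 1 \<or> y = lattice_step x i (- 1)"
  then obtain i where i: "i < length x" "y = lattice_step x i 1 \<or> y = lattice_step x i (- 1)" by blast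
  have "(\<Sum>j<length x. (x ! j - y ! j)\<^sup>2) = (\<Sum>j<length x. if j = i then 1 else 0)"
    using i by (intro sum.cong) (auto simp: lattice_step_def nth_list_update)
  then show "adj x y" using i by (auto simp: adj_def lattice_step_def)
qed

lemma step_inj:
  assumes "i < length x" "j < length x" "s \<noteq> 0" "t \<noteq> 0" "lattice_step x i s = lattice_step x j t"
  shows "i = j \<and> s = t"
proof -
  have "lattice_step x i s ! i = lattice_step x j t ! i" using assms by simp
  then show ?thesis using assms(1-4) by (auto simp: lattice_step_def nth_list_update split: if_splits)
qed

lemma neighbours_eq:
  "{y. adj x y} = (\<lambda>i. lattice_step x i 1) ` {..<length x} \<union> (\<lambda>i. lattice_step x i (- 1)) ` {..<length x}"
  unfolding adj_iff_step by blast

lemma finite_neighbours: "finite {y. adj x y}"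
  unfolding neighbours_eq by simp

text \<open>Opposite neighbours are paired, so that first-order terms cancel in the superharmonicity
  estimate.\<close>

lemma sum_neighbours:
  "(\<Sum>y | adj x y. f y) = (\<Sum>i<length x. f (lattice_step x i 1) + f (lattice_step x i (- 1)))" for f :: "int list \<Rightarrow> real"
proof -
  have "inj_on (\<lambda>i. lattice_step x i s) {..<length x}" if "s \<noteq> 0" for s
    by (rule inj_onI) (use step_inj[OF _ _ that that] in simp)
  moreover have "(\<lambda>i. lattice_step x i 1) ` {..<length x} \<inter> (\<lambda>i. lattice_step x i (- 1)) ` {..<length x} = {}"
  proof -
    have "lattice_step x i 1 \<noteq> lattice_step x j (- 1)" if "i < length x" "j < length x" for i j
      using step_inj[OF that, of 1 "- 1"] by auto
    then show ?thesis by blast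
  qed
  ultimately show ?thesis
    unfolding neighbours_eq by (subst sum.union_disjoint) (auto simp: sum.reindex sum.distrib)
qed

lemma card_neighbours: "card {y. adj x y} = 2 * length x"
proof -
  have "real (card {y. adj x y}) = (\<Sum>y | adj x y. 1)" by simp
  also have "\<dots> = 2 * length x" unfolding sum_neighbours by simp
  finally show ?thesis by linarith
qed

section \<open>A superharmonic function and the Green function bound\<close>

definition radius2 :: "int list \<Rightarrow> int list \<Rightarrow> real" where
  "radius2 x y = 5000 + (\<Sum>i<length x. (real_of_int (y ! i - x ! i))\<^sup>2)"

lemma radius2_step:
  assumes "length y = length x" "i < length x"
  shows "radius2 x (lattice_step y i s) = radius2 x y + (2 * real_of_int (s * (y ! i - x ! i)) + (real_of_int s)\<^sup>2)"
proof -
  have "(\<Sum>j<length x. (real_of_int (lattice_step y i s ! j - x ! j))\<^sup>2)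
      = (\<Sum>j<length x. (real_of_int (y ! j - x ! j))\<^sup>2 + (if j = i then 2 * real_of_int (s * (y ! i - x ! i)) + (real_of_int s)\<^sup>2 else 0))"
    using assms by (intro sum.cong refl) (auto simp: lattice_step_def nth_list_update power2_eq_square algebra_simps)
  also have "\<dots> = (\<Sum>j<length x. (real_of_int (y ! j - x ! j))\<^sup>2) + (2 * real_of_int (s * (y ! i - x ! i)) + (real_of_int s)\<^sup>2)"
    using assms by (simp add: sum.distrib)
  finally show ?thesis by (simp add: radius2_def)
qed

text \<open>The exponent \<open>-1/4\<close> of \<open>|z|^2\<close> is above \<open>-(d - 2)/2\<close> for every \<open>d \<ge> 3\<close>; the additive
  constant in \<open>radius2\<close> makes the lattice errors negligible.\<close>

lemma quartic_decay_superharmonic: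
  assumes len: "length y = d" "length x = d" and d: "3 \<le> d"
  shows "(\<Sum>z | adj y z. radius2 x z powr (- 1 / 4)) \<le> radius2 x y powr (- 1 / 4) * (2 * real d * (1 - 1 / (50 * radius2 x y)))"
proof -
  define R where "R = radius2 x y"
  define t where "t = (\<lambda>i. real_of_int (y ! i - x ! i))"
  have R: "R = 5000 + (\<Sum>i<d. (t i)\<^sup>2)" by (simp add: R_def radius2_def t_def len)
  have T0: "0 \<le> (\<Sum>i<d. (t i)\<^sup>2)" by (intro sum_nonneg) auto
  have R0: "5000 \<le> R" using T0 R by simp
  have site: "radius2 x (lattice_step y i 1) powr (- 1 / 4) + radius2 x (lattice_step y i (- 1)) powr (- 1 / 4)
     \<le> R powr (- 1 / 4) * (2 - 1 / (2 * R) + 11 / 64 * (2 + 8 * (t i)\<^sup>2) / R\<^sup>2)" if i: "i < d" for i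
  proof -
    have ti: "(t i)\<^sup>2 \<le> (\<Sum>i<d. (t i)\<^sup>2)" using i by (intro member_le_sum) auto
    \<comment> \<open>Because \<open>5000\<close> exceeds \<open>64 * 64 + 64\<close>, one step
      changes \<open>R\<close> by at most the fraction 1/64, as \<open>quartic_root_bound\<close>
      requires.\<close>
    have "0 \<le> (\<bar>t i\<bar> - 64)\<^sup>2" by simp
    then have "64 * (1 + 2 * \<bar>t i\<bar>) \<le> 5000 + (t i)\<^sup>2" by (simp add: power2_eq_square algebra_simps abs_mult_self_eq)
    then have big: "64 * (1 + 2 * \<bar>t i\<bar>) \<le> R" using ti R by linarith
    have one: "(R + (2 * s * t i + 1)) powr (- 1 / 4) \<le> R powr (- 1 / 4) * (1 - ((2 * s * t i + 1) / R) / 4 + 11 / 64 * ((2 * s * t i + 1) / R)\<^sup>2)"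
      if s: "\<bar>s\<bar> = 1" for s :: real
    proof -
      have "\<bar>2 * s * t i + 1\<bar> \<le> 1 + 2 * \<bar>t i\<bar>" using s abs_triangle_ineq[of "2 * s * t i" 1] by (simp add: abs_mult)
      then have "64 * \<bar>2 * s * t i + 1\<bar> \<le> 64 * (1 + 2 * \<bar>t i\<bar>)" by (rule mult_left_mono) simp
      then have "64 * \<bar>2 * s * t i + 1\<bar> \<le> R" using big by (rule order_trans)
      then have small: "\<bar>(2 * s * t i + 1) / R\<bar> \<le> 1 / 64" using R0 by (simp add: abs_divide field_simps)
      have "R + (2 * s * t i + 1) = R * (1 + (2 * s * t i + 1) / R)" using R0 by (simp add: field_simps)
      then have "(R + (2 * s * t i + 1)) powr (- 1 / 4) = R powr (- 1 / 4) * (1 + (2 * s * t i + 1) / R) powr (- 1 / 4)"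
        using R0 small by (simp only: powr_mult)
      also have "\<dots> \<le> R powr (- 1 / 4) * (1 - ((2 * s * t i + 1) / R) / 4 + 11 / 64 * ((2 * s * t i + 1) / R)\<^sup>2)"
        by (intro mult_left_mono quartic_root_bound small) auto
      finally show ?thesis .
    qed
    have r: "radius2 x (lattice_step y i 1) = R + (2 * 1 * t i + 1)" "radius2 x (lattice_step y i (- 1)) = R + (2 * (- 1) * t i + 1)"
      using radius2_step[of y x i 1] radius2_step[of y x i "- 1"] len i by (auto simp: R_def t_def)
    have "radius2 x (lattice_step y i 1) powr (- 1 / 4) + radius2 x (lattice_step y i (- 1)) powr (- 1 / 4) \<le>
      R powr (- 1 / 4) * (1 - ((2 * 1 * t i + 1) / R) / 4 + 11 / 64 * ((2 * 1 * t i + 1) / R)\<^sup>2) +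
      R powr (- 1 / 4) * (1 - ((2 * (- 1) * t i + 1) / R) / 4 + 11 / 64 * ((2 * (- 1) * t i + 1) / R)\<^sup>2)"
      unfolding r by (intro add_mono one) auto
    \<comment> \<open>The terms linear in \<open>t i\<close> cancel between the two opposite
      steps.\<close>
    also have "\<dots> = R powr (- 1 / 4) * (2 - 1 / (2 * R) + 11 / 64 * (2 + 8 * (t i)\<^sup>2) / R\<^sup>2)"
      using R0 by (simp add: field_simps power2_eq_square)
    finally show ?thesis .
  qed
  have "(\<Sum>z | adj y z. radius2 x z powr (- 1 / 4))
     \<le> (\<Sum>i<d. R powr (- 1 / 4) * (2 - 1 / (2 * R) + 11 / 64 * (2 + 8 * (t i)\<^sup>2) / R\<^sup>2))"
    unfolding sum_neighbours len using site by (intro sum_mono) auto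
  also have "\<dots> = R powr (- 1 / 4) * (d * (2 - 1 / (2 * R) + 11 / 32 / R\<^sup>2) + 11 / 8 * (\<Sum>i<d. (t i)\<^sup>2) / R\<^sup>2)"
    unfolding sum_distrib_left[symmetric]
    by (simp add: sum.distrib sum_subtractf sum_divide_distrib[symmetric] sum_distrib_left[symmetric] add_divide_distrib algebra_simps)
  also have "\<dots> \<le> R powr (- 1 / 4) * (2 * real d * (1 - 1 / (50 * R)))"
  proof (rule mult_left_mono)
    have "11 / 8 * (\<Sum>i<d. (t i)\<^sup>2) / R\<^sup>2 \<le> 11 / 8 * R / R\<^sup>2"
      using R by (intro divide_right_mono mult_left_mono) auto
    also have "\<dots> = 11 / 8 / R" using R0 by (simp add: power2_eq_square)
    \<comment> \<open>Here \<open>3 \<le> d\<close> is decisive: the resulting coefficient 11/24 is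
      below the 1/2 of the negative term \<open>- d / (2 * R)\<close>.\<close>
    also have "\<dots> \<le> 11 / 24 * d / R" using d R0 by (intro divide_right_mono) auto
    finally have A: "11 / 8 * (\<Sum>i<d. (t i)\<^sup>2) / R\<^sup>2 \<le> 11 / 24 * d / R" .
    have "11 / 32 / R\<^sup>2 = 11 / 32 / R * (1 / R)" by (simp add: power2_eq_square)
    also have "\<dots> \<le> 11 / 32 / R * (1 / 5000)" using R0 by (intro mult_left_mono divide_left_mono) auto
    finally have "d * (11 / 32 / R\<^sup>2) \<le> d * (11 / 32 / R * (1 / 5000))" by (rule mult_left_mono) simp
    moreover have "d * (11 / 32 / R * (1 / 5000)) + 11 / 24 * d / R - d / (2 * R) \<le> - (2 * d / (50 * R))"
      using R0 d by (simp add: field_simps)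
    ultimately show "d * (2 - 1 / (2 * R) + 11 / 32 / R\<^sup>2) + 11 / 8 * (\<Sum>i<d. (t i)\<^sup>2) / R\<^sup>2 \<le> 2 * real d * (1 - 1 / (50 * R))"
      using A by (simp add: algebra_simps)
  qed simp
  finally show ?thesis unfolding R_def .
qed

definition walk_kernel :: "nat \<Rightarrow> int list \<Rightarrow> int list \<Rightarrow> real" where
  "walk_kernel d x y = (if adj x y then 1 / (2 * real d) else 0)"

lemma walk_kernel_sum_le:
  assumes "finite B" "length x = d" "\<And>y. adj x y \<Longrightarrow> 0 \<le> f y"
  shows "(\<Sum>y\<in>B. walk_kernel d x y * f y) \<le> (\<Sum>y | adj x y. f y) / (2 * real d)"
proof -
  have "(\<Sum>y\<in>B. walk_kernel d x y * f y) = (\<Sum>y\<in>{y\<in>B. adj x y}. f y / (2 * real d))"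
    unfolding walk_kernel_def using assms(1) by (auto simp: sum.inter_filter intro!: sum.cong)
  also have "\<dots> \<le> (\<Sum>y | adj x y. f y / (2 * real d))"
    using assms finite_neighbours[of x] by (intro sum_mono2) auto
  finally show ?thesis by (simp add: sum_divide_distrib)
qed

lemma length_adj: "adj x y \<Longrightarrow> length y = length x"
  by (simp add: adj_def)

text \<open>Averaging lowers \<open>F\<close> by at least the fraction
  \<open>1 / (50 * radius2 x y)\<close>. At the pole the radius term is \<open>5000\<close>, so the
  loss there is \<open>\<gamma> = F x / 250000\<close>; hence \<open>F / \<gamma>\<close> is a
  supersolution with value \<open>250000\<close> at \<open>x\<close>.\<close>

lemma substochastic_kernel_box:
  assumes d: "3 \<le> d"
  shows "substochastic_kernel (box d N) (walk_kernel d) 250000"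
proof
  show "finite (box d N)" by (rule finite_box)
  show "box d N \<noteq> {}" using card_box[of d N] by auto
  show "walk_kernel d x y = walk_kernel d y x" for x y
    by (simp add: walk_kernel_def adj_sym[of x y])
  show "0 \<le> walk_kernel d x y" for x y by (simp add: walk_kernel_def)
  show "(\<Sum>y\<in>box d N. walk_kernel d x y) \<le> 1" if x: "x \<in> box d N" for x
  proof -
    have "length x = d" using x by (simp add: box_def)
    then show ?thesis
      using walk_kernel_sum_le[OF finite_box, of x d "\<lambda>_. 1" d N] card_neighbours[of x] d by simp
  qed
  fix x assume "x \<in> box d N"
  then have x: "length x = d" by (simp add: box_def)
  define F where "F = (\<lambda>y. radius2 x y powr (- 1 / 4))"
  define \<gamma> :: real where "\<gamma> = 5000 powr (- 1 / 4) / 250000"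
  have \<gamma>: "0 < \<gamma>" by (simp add: \<gamma>_def)
  have Fx: "F x = 250000 * \<gamma>" by (simp add: F_def \<gamma>_def radius2_def)
  have F0: "0 \<le> F y" for y by (simp add: F_def)
  have r: "5000 \<le> radius2 x y" for y unfolding radius2_def by (auto intro!: sum_nonneg)
  have sup: "(\<Sum>z\<in>box d N. walk_kernel d y z * F z) + (if y = x then \<gamma> else 0) \<le> F y" if "y \<in> box d N" for y
  proof -
    have y: "length y = d" using that by (simp add: box_def)
    have "(\<Sum>z\<in>box d N. walk_kernel d y z * F z) \<le> (\<Sum>z | adj y z. F z) / (2 * real d)"
      using F0 by (intro walk_kernel_sum_le finite_box y)
    also have "\<dots> \<le> F y * (2 * real d * (1 - 1 / (50 * radius2 x y))) / (2 * real d)"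
      unfolding F_def by (intro divide_right_mono quartic_decay_superharmonic y x d) auto
    also have "\<dots> = F y * (1 - 1 / (50 * radius2 x y))" using d by simp
    also have "\<dots> = F y - F y / (50 * radius2 x y)" by (simp add: right_diff_distrib)
    finally have *: "(\<Sum>z\<in>box d N. walk_kernel d y z * F z) \<le> F y - F y / (50 * radius2 x y)" .
    have "(if y = x then \<gamma> else 0) \<le> F y / (50 * radius2 x y)"
    proof (cases "y = x")
      case True
      have "radius2 x x = 5000" by (simp add: radius2_def)
      then show ?thesis using True Fx by simp
    next
      case False
      then show ?thesis using F0[of y] r[of y] by simp
    qed
    then show ?thesis using * by linarith
  qed
  show "\<exists>f. (\<forall>y\<in>box d N. 0 \<le> f y) \<and>
      (\<forall>y\<in>box d N. (\<Sum>z\<in>box d N. walk_kernel d y z * f z) + (if y = x then 1 else 0) \<le> f y) \<and> f x \<le> 250000"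
  proof (intro exI[of _ "\<lambda>y. F y / \<gamma>"] conjI ballI)
    fix y assume y: "y \<in> box d N"
    have "((\<Sum>z\<in>box d N. walk_kernel d y z * F z) + (if y = x then \<gamma> else 0)) / \<gamma> \<le> F y / \<gamma>"
      using sup[OF y] \<gamma> by (intro divide_right_mono) auto
    then show "(\<Sum>z\<in>box d N. walk_kernel d y z * (F z / \<gamma>)) + (if y = x then 1 else 0) \<le> F y / \<gamma>"
      using \<gamma> by (cases "y = x") (auto simp: add_divide_distrib sum_divide_distrib)
  qed (use F0 \<gamma> Fx in auto)
qed

section \<open>Boundary shell and Hamiltonian of the box\<close>

lemma box_neighbour:
  assumes "x \<in> box d N" "adj x y" "2 + N \<le> N'"
  shows "y \<in> box d N'"
proof -
  \<comment> \<open>The half-width is \<open>N div 2\<close>, so one more layer of sites costs an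
    increase of \<open>N\<close> by two.\<close>
  have lo: "int (N div 2) + 1 \<le> int (N' div 2)" using assms(3) by linarith
  obtain i where i: "i < length x" "y = lattice_step x i 1 \<or> y = lattice_step x i (- 1)"
    using assms(2) by (auto simp only: adj_iff_step)
  have x: "length x = d" "\<And>j. j < length x \<Longrightarrow> \<bar>x ! j\<bar> \<le> int (N div 2)"
    using assms(1) by (auto simp: box_def)
  have "\<bar>y ! j\<bar> \<le> int (N' div 2)" if j: "j < length x" for j
  proof -
    have "y ! j = x ! j \<or> y ! j = x ! j + 1 \<or> y ! j = x ! j - 1"
      using i j by (cases "i = j") (auto simp: lattice_step_def nth_list_update)
    then show ?thesis using x(2)[OF j] lo by linarith
  qed
  then show ?thesis using x(1) length_adj[OF assms(2)] by (auto simp: box_def in_set_conv_nth)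
qed

text \<open>The walk cannot leave in one step from the inner box, and \<open>killing\<close> is at
  most \<open>1\<close> in the remaining shell. Bernoulli's inequality bounds the share of that
  shell in the volume.\<close>

lemma sum_killing_box_le:
  assumes d: "3 \<le> d" and N: "2 \<le> N"
  shows "(\<Sum>x\<in>box d N. substochastic_kernel.killing (box d N) (walk_kernel d) x) \<le> 2 * real d / N * card (box d N)"
proof -
  interpret substochastic_kernel "box d N" "walk_kernel d" 250000 by (rule substochastic_kernel_box[OF d])
  have sub: "box d (N - 2) \<subseteq> box d N" 
  proof -
    have "(N - 2) div 2 \<le> N div 2" by (rule div_le_mono) simp
    then show ?thesis by (force simp: box_def)
  qed
  have "killing x = 0" if x: "x \<in> box d (N - 2)" for x
  proof -
    have "{y \<in> box d N. adj x y} = {y. adj x y}" using box_neighbour[OF x, of _ N] N by auto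
    moreover have "(\<Sum>y\<in>box d N. walk_kernel d x y) = (\<Sum>y\<in>{y \<in> box d N. adj x y}. 1 / (2 * real d))"
      unfolding walk_kernel_def using finite_box[of d N] by (simp add: sum.inter_filter del: sum_constant)
    ultimately show ?thesis
      using x d unfolding killing_def by (simp add: card_neighbours box_def)
  qed
  then have "(\<Sum>x\<in>box d N. killing x) = (\<Sum>x\<in>box d N - box d (N - 2). killing x)"
    using finite_box by (intro sum.mono_neutral_right) auto
  also have "\<dots> \<le> (\<Sum>x\<in>box d N - box d (N - 2). 1)" using killing_bounds by (intro sum_mono) auto
  also have "\<dots> = real (card (box d N)) - card (box d (N - 2))"
    using sub finite_box[of d N] by (simp add: card_Diff_subset finite_subset card_mono of_nat_diff)
  also have "\<dots> \<le> 2 * real d / N * card (box d N)"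
  proof -
    define m where "m = N div 2"
    have m: "1 \<le> m" "N \<le> 2 * m + 1" "(N - 2) div 2 = m - 1" using N by (auto simp: m_def)
    have c: "real (card (box d N)) = (2 * real m + 1) ^ d" "real (card (box d (N - 2))) = (2 * real m - 1) ^ d"
      using m by (auto simp: card_box m_def[symmetric] of_nat_diff algebra_simps)
    have "1 + d * (- 2 / (2 * real m + 1)) \<le> (1 + (- 2 / (2 * real m + 1))) ^ d"
      using m by (intro Bernoulli_inequality) (auto simp: field_simps)
    also have "1 + (- 2 / (2 * real m + 1)) = (2 * real m - 1) / (2 * real m + 1)" by (simp add: field_simps)
    finally have "(2 * real m + 1) ^ d * (1 + d * (- 2 / (2 * real m + 1))) \<le> (2 * real m - 1) ^ d"
      by (simp add: power_divide pos_le_divide_eq mult.commute)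
    then have "(2 * real m + 1) ^ d - (2 * real m - 1) ^ d \<le> 2 * real d / (2 * real m + 1) * (2 * real m + 1) ^ d"
      by (simp add: algebra_simps)
    also have "\<dots> \<le> 2 * real d / N * (2 * real m + 1) ^ d"
      using m N by (intro mult_right_mono divide_left_mono) auto
    finally show ?thesis unfolding c .
  qed
  finally show ?thesis .
qed

lemma finite_outer_boundary: "finite (outer_boundary d N)"
proof (rule finite_subset)
  show "outer_boundary d N \<subseteq> (\<Union>x\<in>box d N. {y. adj x y})" by (auto simp: outer_boundary_def)
qed (simp add: finite_box finite_neighbours)

text \<open>Expand the squares. Each box site has all its \<open>2 * d\<close> neighbours in the box
  or its outer boundary, and pairs are ordered, so the prefactor \<open>1 / (8 * real d)\<close>
  leaves \<open>1 / 2\<close> in front of both the diagonal and the cross terms. Boundary sites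
  carry the value \<open>0\<close>.\<close>

lemma hamiltonian_eq_energy:
  assumes d: "3 \<le> d"
  shows "hamiltonian d N \<phi> = substochastic_kernel.energy (box d N) (walk_kernel d) (\<lambda>_. 0) \<phi>"
proof -
  interpret substochastic_kernel "box d N" "walk_kernel d" 250000 by (rule substochastic_kernel_box[OF d])
  define V where "V = box d N \<union> outer_boundary d N"
  define e where "e = ext0 d N \<phi>"
  have fV: "finite V" by (simp add: V_def finite_box finite_outer_boundary)
  have BV: "box d N \<subseteq> V" by (simp add: V_def)
  have e0: "e x = 0" if "x \<notin> box d N" for x using that by (simp add: e_def ext0_def)
  have eB: "e x = \<phi> x" if "x \<in> box d N" for x using that by (simp add: e_def ext0_def)
  have nb: "{y \<in> V. adj x y} = {y. adj x y}" if x: "x \<in> box d N" for x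
    using x length_adj[of x] by (auto simp: V_def outer_boundary_def box_def)
  have deg: "(\<Sum>x\<in>V. \<Sum>y | y \<in> V \<and> adj x y. (e x)\<^sup>2) = 2 * real d * (\<Sum>x\<in>box d N. (\<phi> x)\<^sup>2)"
  proof -
    have "(\<Sum>x\<in>V. \<Sum>y | y \<in> V \<and> adj x y. (e x)\<^sup>2) = (\<Sum>x\<in>box d N. \<Sum>y | y \<in> V \<and> adj x y. (e x)\<^sup>2)"
      using fV BV e0 by (intro sum.mono_neutral_right) auto
    also have "\<dots> = (\<Sum>x\<in>box d N. 2 * real d * (\<phi> x)\<^sup>2)"
    proof (intro sum.cong refl)
      fix x assume x: "x \<in> box d N"
      then have "length x = d" by (simp add: box_def)
      then show "(\<Sum>y | y \<in> V \<and> adj x y. (e x)\<^sup>2) = 2 * real d * (\<phi> x)\<^sup>2"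
        using nb[OF x] card_neighbours[of x] by (simp add: eB[OF x])
    qed
    finally show ?thesis by (simp add: sum_distrib_left)
  qed
  have deg': "(\<Sum>x\<in>V. \<Sum>y | y \<in> V \<and> adj x y. (e y)\<^sup>2) = (\<Sum>x\<in>V. \<Sum>y | y \<in> V \<and> adj x y. (e x)\<^sup>2)"
    using sum.swap_restrict[OF fV fV, of "\<lambda>x y. (e y)\<^sup>2" adj] by (simp add: adj_sym)
  have cross: "(\<Sum>x\<in>V. \<Sum>y | y \<in> V \<and> adj x y. e x * e y) = 2 * real d * (\<Sum>x\<in>box d N. \<Sum>y\<in>box d N. walk_kernel d x y * \<phi> x * \<phi> y)"
  proof -
    have "(\<Sum>x\<in>V. \<Sum>y | y \<in> V \<and> adj x y. e x * e y) = (\<Sum>x\<in>box d N. \<Sum>y | y \<in> V \<and> adj x y. e x * e y)"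
      using fV BV e0 by (intro sum.mono_neutral_right) auto
    also have "\<dots> = (\<Sum>x\<in>box d N. \<Sum>y | y \<in> box d N \<and> adj x y. e x * e y)"
      using fV BV e0 by (intro sum.cong refl sum.mono_neutral_right) auto
    also have "\<dots> = (\<Sum>x\<in>box d N. \<Sum>y\<in>box d N. 2 * real d * (walk_kernel d x y * \<phi> x * \<phi> y))"
    proof (rule sum.cong[OF refl])
      fix x assume x: "x \<in> box d N"
      have "(\<Sum>y | y \<in> box d N \<and> adj x y. e x * e y) = (\<Sum>y\<in>box d N. if adj x y then e x * e y else 0)"
        using finite_box[of d N] by (simp add: sum.inter_filter)
      also have "\<dots> = (\<Sum>y\<in>box d N. 2 * real d * (walk_kernel d x y * \<phi> x * \<phi> y))"
        using d x by (intro sum.cong refl) (auto simp: walk_kernel_def eB)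
      finally show "(\<Sum>y | y \<in> box d N \<and> adj x y. e x * e y) = (\<Sum>y\<in>box d N. 2 * real d * (walk_kernel d x y * \<phi> x * \<phi> y))" .
    qed
    finally show ?thesis by (simp add: sum_distrib_left)
  qed
  have "(\<Sum>p \<in> {(x,y). x \<in> V \<and> y \<in> V \<and> adj x y}. (e (fst p) - e (snd p))\<^sup>2)
     = (\<Sum>x\<in>V. \<Sum>y | y \<in> V \<and> adj x y. (e x - e y)\<^sup>2)"
  proof -
    have "{(x,y). x \<in> V \<and> y \<in> V \<and> adj x y} = Sigma V (\<lambda>x. {y. y \<in> V \<and> adj x y})" by auto
    then show ?thesis using fV by (simp add: sum.Sigma case_prod_beta)
  qed
  also have "\<dots> = (\<Sum>x\<in>V. \<Sum>y | y \<in> V \<and> adj x y. (e x)\<^sup>2) + (\<Sum>x\<in>V. \<Sum>y | y \<in> V \<and> adj x y. (e y)\<^sup>2)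
      - 2 * (\<Sum>x\<in>V. \<Sum>y | y \<in> V \<and> adj x y. e x * e y)"
    unfolding sum_distrib_left sum.distrib[symmetric] sum_subtractf[symmetric]
    by (intro sum.cong refl) (simp add: power2_eq_square algebra_simps)
  finally show ?thesis
    unfolding hamiltonian_def V_def[symmetric] e_def[symmetric] deg' deg cross energy_def using d
    by (simp add: field_simps)
qed


section \<open>Contact density of the conditioned measure\<close>

theorem mainTheorem2:
  fixes d :: nat and a b :: real
  assumes "d \<ge> 3" and "a > 0" and "b > 0"
  shows "\<exists>\<epsilon>>0. \<exists>\<eta>>0. \<forall>\<^sub>F N in sequentially.
    cond_prob (Ptilde d N a b)
      {\<phi> \<in> space (ref_measure d N). real (xi d N a \<phi>) > \<epsilon> * real N ^ d}
      (Omega_plus d N)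
    \<ge> 1 - exp (- \<eta> * real N ^ d)"
proof -
  obtain \<mu> :: real where \<mu>: "0 < \<mu>"
    and growth: "\<And>(I :: int list set) w. substochastic_kernel I w 250000 \<Longrightarrow>
       (\<Sum>x\<in>I. substochastic_kernel.killing I w x) \<le> \<mu> * card I \<Longrightarrow>
       ennreal (exp (\<mu> * card I) * substochastic_kernel.Z I w (\<lambda>_. 0)) \<le> substochastic_kernel.Zpin I w a b"
    using pinned_partition_growth[of a b 250000] assms by auto
  \<comment> \<open>With at most \<open>\<mu> / (2 * b) * real N ^ d\<close> contacts, pinning
    contributes at most half of the growth exponent \<open>\<mu> * real N ^ d\<close>; the other
    half is the decay rate.\<close>
  have claim: "1 - exp (- (\<mu> / 2) * real N ^ d) \<le> cond_prob (Ptilde d N a b)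
      {\<phi> \<in> space (ref_measure d N). real (xi d N a \<phi>) > \<mu> / (2 * b) * real N ^ d} (Omega_plus d N)"
    if N: "2 \<le> N" "2 * real d / \<mu> \<le> N" for N
  proof -
    interpret substochastic_kernel "box d N" "walk_kernel d" 250000
      by (rule substochastic_kernel_box[OF assms(1)])
    let ?n = "real (card (box d N))" and ?H = "gibbs (\<lambda>_. 0)"
    interpret H: finite_measure ?H by (rule finite_measure_gibbs) simp
    have Z0: "0 < Z (\<lambda>_. 0)" by (rule Z_pos) simp
    have ref: "ref_measure d N = leb" by (simp add: ref_measure_def leb_def)
    have "(\<Sum>x\<in>box d N. killing x) \<le> 2 * real d / N * ?n" by (rule sum_killing_box_le[OF assms(1) N(1)])
    \<comment> \<open>For this \<open>N\<close> the boundary shell is thin enough for the growth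
      estimate with rate \<open>\<mu>\<close>.\<close>
    also have "\<dots> \<le> \<mu> * ?n" using N \<mu> by (intro mult_right_mono) (auto simp: field_simps)
    finally have Zpin: "ennreal (exp (\<mu> * ?n) * Z (\<lambda>_. 0)) \<le> Zpin a b"
      using growth[OF substochastic_kernel_axioms] by simp
    have Nn: "real N ^ d \<le> ?n"
    proof -
      have "N \<le> 2 * (N div 2) + 1" by simp
      then have "N ^ d \<le> card (box d N)" unfolding card_box by (rule power_mono) simp
      then show ?thesis by (metis of_nat_le_iff of_nat_power)
    qed
    have xi: "real (xi d N a \<phi>) = contacts a 0 \<phi>" for \<phi>
    proof -
      have "contacts a 0 \<phi> = (\<Sum>x\<in>box d N. if 0 \<le> \<phi> x \<and> \<phi> x \<le> a then 1 else 0)"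
        unfolding contacts_def by (intro sum.cong) (auto simp: indicator_def)
      then show ?thesis using finite_box[of d N] by (simp add: xi_def sum.inter_filter[symmetric])
    qed
    have Om: "Omega_plus d N = above 0" by (simp add: Omega_plus_def above_def ref)
    define W where "W = (\<lambda>\<phi>. exp (- energy (\<lambda>_. 0) \<phi> + b * contacts a 0 \<phi>))"
    have W: "weight d N a b = W"
      unfolding weight_def W_def hamiltonian_eq_energy[OF assms(1)] xi by simp
    have [measurable]: "W \<in> borel_measurable leb" unfolding W_def by measurable
    \<comment> \<open>The pinned measure before normalisation; the partition function cancels in the
      conditional probability.\<close>
    define \<nu> where "\<nu> = density leb (\<lambda>\<phi>. ennreal (W \<phi>))"
    have \<nu>_eq: "emeasure \<nu> S = (\<integral>\<^sup>+\<phi>. indicator S \<phi> * ennreal (exp (b * contacts a 0 \<phi>)) \<partial>?H)"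
      if S: "S \<in> sets leb" for S
    proof -
      have "emeasure \<nu> S = (\<integral>\<^sup>+\<phi>. ennreal (W \<phi>) * indicator S \<phi> \<partial>leb)"
        unfolding \<nu>_def using S by (subst emeasure_density) auto
      also have "\<dots> = (\<integral>\<^sup>+\<phi>. ennreal (exp (- energy (\<lambda>_. 0) \<phi>)) * (indicator S \<phi> * ennreal (exp (b * contacts a 0 \<phi>))) \<partial>leb)"
        by (intro nn_integral_cong) (auto simp: W_def indicator_def ennreal_mult[symmetric] exp_add[symmetric])
      also have "\<dots> = (\<integral>\<^sup>+\<phi>. indicator S \<phi> * ennreal (exp (b * contacts a 0 \<phi>)) \<partial>?H)"
        unfolding gibbs_def using S by (subst nn_integral_density) auto
      finally show ?thesis .
    qed
    \<comment> \<open>Bounding the pinning factor by its largest value on \<open>S\<close> and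
      forgetting the restriction to \<open>S\<close> leaves the free partition function.\<close>
    have \<nu>_le: "emeasure \<nu> S \<le> ennreal (exp L * Z (\<lambda>_. 0))"
      if S: "S \<in> sets leb" and L: "\<And>\<phi>. \<phi> \<in> S \<Longrightarrow> b * contacts a 0 \<phi> \<le> L" for S L
    proof -
      have "emeasure \<nu> S \<le> (\<integral>\<^sup>+\<phi>. ennreal (exp L) * indicator (space leb) \<phi> \<partial>?H)"
        unfolding \<nu>_eq[OF S] using L sets.sets_into_space[OF S]
        by (intro nn_integral_mono) (auto simp: indicator_def)
      also have "\<dots> = ennreal (exp L) * emeasure ?H (space leb)" by (simp add: nn_integral_cmult_indicator)
      finally show ?thesis by (simp add: Z_def H.emeasure_eq_measure ennreal_mult)
    qed
    \<comment> \<open>The crude bound with every site in contact is enough for finiteness of the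
      total mass.\<close>
    have "emeasure \<nu> (space leb) \<le> ennreal (exp (b * ?n) * Z (\<lambda>_. 0))"
      using contacts_bounds(2)[of a 0] assms by (intro \<nu>_le) auto
    then have "emeasure \<nu> (space leb) < \<infinity>" by (rule le_less_trans) simp
    then interpret \<nu>: finite_measure \<nu> by (intro finite_measureI) (simp add: \<nu>_def)
    have \<nu>sets: "sets \<nu> = sets leb" by (simp add: \<nu>_def)
    have part: "partition_fn d N a b = emeasure \<nu> (space leb)"
      unfolding partition_fn_def ref W \<nu>_def by (subst emeasure_density) (auto intro!: nn_integral_cong)
    have Om_sets: "above 0 \<in> sets leb" by measurable
    have \<nu>Om: "exp (\<mu> * ?n) * Z (\<lambda>_. 0) \<le> measure \<nu> (above 0)"
      using Zpin unfolding Zpin_def \<nu>_eq[OF Om_sets, symmetric]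
      by (simp add: \<nu>.emeasure_eq_measure)
    have posZ: "0 < exp (\<mu> * ?n) * Z (\<lambda>_. 0)" using Z0 by simp
    then have Opos: "0 < measure \<nu> (above 0)" using \<nu>Om by linarith
    have Tpos: "0 < measure \<nu> (space leb)"
      using Opos \<nu>.finite_measure_mono[of "above 0" "space leb"] \<nu>sets by (auto simp: above_def)
    have Pt: "measure (Ptilde d N a b) S = measure \<nu> S / measure \<nu> (space leb)" if S: "S \<in> sets leb" for S
    proof -
      have "emeasure (Ptilde d N a b) S = (\<integral>\<^sup>+\<phi>. (ennreal (W \<phi>) * indicator S \<phi>) / emeasure \<nu> (space leb) \<partial>leb)"
        unfolding Ptilde_def ref W part using S
        by (subst emeasure_density) (auto intro!: nn_integral_cong simp: indicator_def)
      also have "\<dots> = emeasure \<nu> S / emeasure \<nu> (space leb)"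
        using S by (subst nn_integral_divide) (auto simp: \<nu>_def emeasure_density)
      also have "\<dots> = ennreal (measure \<nu> S / measure \<nu> (space leb))"
        unfolding \<nu>.emeasure_eq_measure using Tpos by (simp add: divide_ennreal)
      finally show ?thesis by (simp add: measure_def)
    qed
    define A where "A = {\<phi> \<in> space leb. \<mu> / (2 * b) * real N ^ d < contacts a 0 \<phi>}"
    have A [measurable]: "A \<in> sets leb" unfolding A_def by measurable
    have "emeasure \<nu> (above 0 - A) \<le> ennreal (exp (\<mu> / 2 * real N ^ d) * Z (\<lambda>_. 0))"
    proof (rule \<nu>_le)
      fix \<phi> assume "\<phi> \<in> above 0 - A"
      then have "contacts a 0 \<phi> \<le> \<mu> / (2 * b) * real N ^ d" by (auto simp: A_def above_def)
      then have "b * contacts a 0 \<phi> \<le> b * (\<mu> / (2 * b) * real N ^ d)" using assms by (intro mult_left_mono) auto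
      then show "b * contacts a 0 \<phi> \<le> \<mu> / 2 * real N ^ d" using assms by simp
    qed measurable
    then have "measure \<nu> (above 0 - A) \<le> exp (\<mu> / 2 * real N ^ d) * Z (\<lambda>_. 0)"
      using Z0 by (simp add: \<nu>.emeasure_eq_measure)
    also have "\<dots> = exp (- (\<mu> / 2) * real N ^ d) * (exp (\<mu> * real N ^ d) * Z (\<lambda>_. 0))"
      by (simp add: mult.assoc[symmetric] exp_add[symmetric])
    also have "\<dots> \<le> exp (- (\<mu> / 2) * real N ^ d) * measure \<nu> (above 0)"
    proof (rule mult_left_mono)
      have "exp (\<mu> * real N ^ d) * Z (\<lambda>_. 0) \<le> exp (\<mu> * ?n) * Z (\<lambda>_. 0)"
        using Nn \<mu> Z0 by simp
      then show "exp (\<mu> * real N ^ d) * Z (\<lambda>_. 0) \<le> measure \<nu> (above 0)" using \<nu>Om by (rule order_trans)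
    qed simp
    finally have small: "measure \<nu> (above 0 - A) \<le> exp (- (\<mu> / 2) * real N ^ d) * measure \<nu> (above 0)" .
    have "measure \<nu> (above 0 - A) = measure \<nu> (above 0) - measure \<nu> (A \<inter> above 0)"
      using \<nu>.finite_measure_Diff'[of "above 0" A] \<nu>sets by (simp add: Int_commute)
    then have "(1 - exp (- (\<mu> / 2) * real N ^ d)) * measure \<nu> (above 0) \<le> measure \<nu> (A \<inter> above 0)"
      using small by (simp add: algebra_simps)
    then have "1 - exp (- (\<mu> / 2) * real N ^ d) \<le> measure \<nu> (A \<inter> above 0) / measure \<nu> (above 0)"
      using Opos by (simp add: pos_le_divide_eq)
    also have "\<dots> = cond_prob (Ptilde d N a b) A (above 0)"
      unfolding cond_prob_def using Tpos by (simp add: Pt)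
    finally show ?thesis unfolding Om A_def ref xi .
  qed
  have "\<forall>\<^sub>F N in sequentially. 1 - exp (- (\<mu> / 2) * real N ^ d) \<le> cond_prob (Ptilde d N a b)
      {\<phi> \<in> space (ref_measure d N). real (xi d N a \<phi>) > \<mu> / (2 * b) * real N ^ d} (Omega_plus d N)"
    using eventually_ge_at_top[of "max 2 (nat \<lceil>2 * real d / \<mu>\<rceil>)"]
  proof eventually_elim
    case (elim N)
    then have "2 \<le> N" "2 * real d / \<mu> \<le> N" by linarith+
    then show ?case by (rule claim)
  qed
  moreover have "0 < \<mu> / (2 * b)" "0 < \<mu> / 2" using \<mu> assms by auto
  ultimately show ?thesis by blast
qed

end
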